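(* Assume that $\mathsf{cov}(\mathcal{M})=\mathfrak{c}$. Then there exist $\mathfrak{c}$-Luzin subgroups $L_1,L_2$ of ${}^{\mathbb{N}}\mathbb{R}$, each satisfying $\mathsf{S}_1(\mathcal{B}_\Omega,\mathcal{B}_\Omega)$, such that the group $L_1\times L_2$ is not $o$-bounded. (Moreover, $L_1$ and $L_2$ can be taken to be vector spaces over $\mathbb{Q}$.)
   Context: $\mathfrak{c}=|\mathbb{R}|$. ${}^{\mathbb{N}}\mathbb{R}$ is the additive group of all functions from $\mathbb{N}$ to $\mathbb{R}$ with the Tychonoff product topology; subgroups carry the subspace topology. $\mathsf{cov}(\mathcal{M})=\mathfrak{c}$ means that $\mathbb{R}$ (equivalently, any complete separable metric space without isolated points) is not a union of fewer than $\mathfrak{c}$ many meager sets. A subgroup $L$ of ${}^{\mathbb{N}}\mathbb{R}$ is $\kappa$-Luzin if $|L|\ge\kappa$ and $|L\cap M|<\kappa$ for each meager set $M\subseteq{}^{\mathbb{N}}\mathbb{R}$. A topological group $G$ is $o$-bounded if for each sequence $\{U_n\}_{n\in\mathbb{N}}$ of neighborhoods of the unit element there is a sequence $\{F_n\}_{n\in\mathbb{N}}$ of finite subsets of $G$ such that $G=\bigcup_n F_n\cdot U_n$. For a topological space $X$, a countable Borel $\omega$-cover of $X$ is a countable family $\mathcal{U}$ of Borel subsets of $X$ covering $X$ such that $X\notin\mathcal{U}$ and each finite $F\subseteq X$ is contained in some $U\in\mathcal{U}$; $\mathcal{B}_\Omega$ is the collection of these covers. $X$ satisfies $\mathsf{S}_1(\mathcal{B}_\Omega,\mathcal{B}_\Omega)$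 if for each sequence $\{\mathcal{U}_n\}_{n\in\mathbb{N}}$ of members of $\mathcal{B}_\Omega$ there are $U_n\in\mathcal{U}_n$ ($n\in\mathbb{N}$) with $\{U_n:n\in\mathbb{N}\}\in\mathcal{B}_\Omega$. *)

theory Defs
  imports
    "HOL-Analysis.Analysis"
    "HOL-Library.Function_Algebras"
    "HOL-Library.Equipollence"
begin

text \<open>
  The group of all real sequences is the type \<^typ>\<open>nat \<Rightarrow> real\<close>: pointwise addition is provided by
  \<^theory>\<open>HOL-Library.Function_Algebras\<close>, the Tychonoff product topology by
  \<^theory>\<open>HOL-Analysis.Function_Topology\<close>. The following instances check that pointwise operations and
  product topologies fit together to topological groups.
\<close>

lemma tendsto_fun_iff:
  fixes f :: "'a \<Rightarrow> 'i \<Rightarrow> 'b::topological_space"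
  shows "(f \<longlongrightarrow> l) F \<longleftrightarrow> (\<forall>i. ((\<lambda>x. f x i) \<longlongrightarrow> l i) F)"
  using limitin_componentwise[of "\<lambda>_::'i. euclidean :: 'b topology" UNIV f l F]
  by (simp add: euclidean_product_topology)

instance "fun" :: (type, topological_monoid_add) topological_monoid_add
proof
  fix a b :: "'a \<Rightarrow> 'b"
  have coord: "((\<lambda>x. x i) \<longlongrightarrow> c i) (nhds c)" for c :: "'a \<Rightarrow> 'b" and i
    using tendsto_fun_iff[of "\<lambda>x. x" c "nhds c"] by (simp add: filterlim_ident)
  show "((\<lambda>p. fst p + snd p) \<longlongrightarrow> a + b) (nhds a \<times>\<^sub>F nhds b)"
    unfolding tendsto_fun_iff plus_fun_apply
    by (intro allI tendsto_add filterlim_compose[OF coord] filterlim_fst filterlim_snd)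
qed

instance "fun" :: (type, topological_group_add) topological_group_add
proof
  fix a :: "'a \<Rightarrow> 'b"
  have coord: "((\<lambda>x. x i) \<longlongrightarrow> a i) (nhds a)" for i
    using tendsto_fun_iff[of "\<lambda>x. x" a "nhds a"] by (simp add: filterlim_ident)
  show "(uminus \<longlongrightarrow> - a) (nhds a)"
    unfolding tendsto_fun_iff by (auto simp: fun_Compl_def intro!: tendsto_minus coord)
qed

instance prod :: (topological_monoid_add, topological_monoid_add) topological_monoid_add
proof
  fix a b :: "'a \<times> 'b"
  have 1: "(fst \<longlongrightarrow> fst c) (nhds c)" and 2: "(snd \<longlongrightarrow> snd c) (nhds c)" for c :: "'a \<times> 'b"
    using tendsto_fst[OF filterlim_ident, of c] tendsto_snd[OF filterlim_ident, of c] by auto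
  show "((\<lambda>p. fst p + snd p) \<longlongrightarrow> a + b) (nhds a \<times>\<^sub>F nhds b)"
    unfolding plus_prod_def
    by (intro tendsto_Pair tendsto_add filterlim_compose[OF 1] filterlim_compose[OF 2]
        filterlim_fst filterlim_snd)
qed

instance prod :: (topological_group_add, topological_group_add) topological_group_add
proof
  fix a :: "'a \<times> 'b"
  have "((\<lambda>x. (- fst x, - snd x)) \<longlongrightarrow> (- fst a, - snd a)) (nhds a)"
    by (intro tendsto_Pair tendsto_minus tendsto_fst tendsto_snd filterlim_ident)
  moreover have "uminus = (\<lambda>x :: 'a \<times> 'b. (- fst x, - snd x))"
    by (simp add: fun_eq_iff uminus_prod_def)
  ultimately show "(uminus \<longlongrightarrow> - a) (nhds a)"
    by (metis uminus_prod_def)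
qed


definition add_subgroup :: "'a::group_add set \<Rightarrow> bool" where
  "add_subgroup G \<longleftrightarrow> 0 \<in> G \<and> (\<forall>x\<in>G. \<forall>y\<in>G. x + y \<in> G) \<and> (\<forall>x\<in>G. - x \<in> G)"

definition rat_scale :: "rat \<Rightarrow> (nat \<Rightarrow> real) \<Rightarrow> nat \<Rightarrow> real" where
  "rat_scale q f = (\<lambda>n. of_rat q * f n)"

interpretation rat_fun: vector_space rat_scale
  by unfold_locales (auto simp: rat_scale_def fun_eq_iff algebra_simps of_rat_add of_rat_mult)


definition nowhere_dense :: "'a::topological_space set \<Rightarrow> bool" where
  "nowhere_dense S \<longleftrightarrow> interior (closure S) = {}"

definition meager :: "'a::topological_space set \<Rightarrow> bool" where
  "meager M \<longleftrightarrow> (\<exists>N :: nat \<Rightarrow> 'a set. (\<forall>n. nowhere_dense (N n)) \<and> M = (\<Union>n. N n))"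

text \<open>
  Cardinals are represented by sets of that cardinality and compared with \<^const>\<open>lepoll\<close> and
  \<^const>\<open>lesspoll\<close>; the continuum is \<^term>\<open>UNIV :: real set\<close>.
\<close>

definition cov_meager_eq_continuum :: bool where
  "cov_meager_eq_continuum \<longleftrightarrow>
     (\<forall>\<M> :: real set set.
        \<M> \<prec> (UNIV :: real set) \<and> (\<forall>M\<in>\<M>. meager M) \<longrightarrow> \<Union>\<M> \<noteq> UNIV)"

definition Luzin :: "'k set \<Rightarrow> 'a::topological_space set \<Rightarrow> bool" where
  "Luzin \<kappa> L \<longleftrightarrow> \<kappa> \<lesssim> L \<and> (\<forall>M. meager M \<longrightarrow> L \<inter> M \<prec> \<kappa>)"


text \<open>
  A set \<open>G\<close> (intended: a subgroup) is regarded as a topological group with the subspace topology;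
  neighbourhoods in \<open>G\<close> need not be open.
\<close>

definition o_bounded :: "'a::topological_group_add set \<Rightarrow> bool" where
  "o_bounded G \<longleftrightarrow>
     (\<forall>U :: nat \<Rightarrow> 'a set.
        (\<forall>n. U n \<subseteq> G \<and> (\<exists>V. openin (top_of_set G) V \<and> 0 \<in> V \<and> V \<subseteq> U n)) \<longrightarrow>
        (\<exists>F :: nat \<Rightarrow> 'a set.
           (\<forall>n. finite (F n) \<and> F n \<subseteq> G) \<and> G = (\<Union>n. {f + u | f u. f \<in> F n \<and> u \<in> U n})))"


definition borel_subsets :: "'a::topological_space set \<Rightarrow> 'a set set" where
  "borel_subsets X = sigma_sets X {U. openin (top_of_set X) U}"

definition borel_omega_covers :: "'a::topological_space set \<Rightarrow> 'a set set set" where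
  "borel_omega_covers X =
     {\<U>. countable \<U> \<and> \<U> \<subseteq> borel_subsets X \<and> \<Union>\<U> = X \<and> X \<notin> \<U> \<and>
          (\<forall>F. finite F \<and> F \<subseteq> X \<longrightarrow> (\<exists>U\<in>\<U>. F \<subseteq> U))}"

definition S1 :: "'a set set set \<Rightarrow> 'a set set set \<Rightarrow> bool" where
  "S1 \<A> \<B> \<longleftrightarrow>
     (\<forall>\<U> :: nat \<Rightarrow> 'a set set.
        (\<forall>n. \<U> n \<in> \<A>) \<longrightarrow>
        (\<exists>U :: nat \<Rightarrow> 'a set. (\<forall>n. U n \<in> \<U> n) \<and> range U \<in> \<B>))"

end

(*
  Fix a well-order of the reals of type c and choose g a and h a = z a - g a by recursion on a, where z
  runs through all real sequences. Since cov(M) = c, both can be taken outside the fewer than c many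
  meager sets that arise as follows: M is a Borel subset of the space T of sequences of elements of
  X = R^N that was listed before stage a, ps is a tuple of earlier points whose section of M is meager
  in T, and by the Kuratowski-Ulam theorem the section at ps extended by x is meager for all x outside
  a meager set. Hence every later increasing tuple is generic over every listed M. Since there are only
  c many countable families of Borel sets, all of them can be listed.

  Let L be the rational span of the g a with a in a set of indices; the remaining values of g are kept
  as Cohen-generic selectors. Genericity of single entries gives the Luzin property. For a sequence of
  countable Borel omega-covers of L, genericity shows that from each cover and over any tuple of earlier
  points, every finite set of linear forms is caught in non-meagerly many places by one member of the
  cover; a generic selector then picks members that catch every finite subset of L.
  The sums g a + h a = z a exhaust R^N, which is not o-bounded, so the product of the two spans is not.
*)

theory Submission
  imports Defs
begin

unbundle cardinal_syntax

section \<open>Meager sets\<close>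

lemma nowhere_dense_subset: "nowhere_dense N \<Longrightarrow> M \<subseteq> N \<Longrightarrow> nowhere_dense M"
  unfolding nowhere_dense_def using interior_mono closure_mono by blast

lemma meagerI: "(\<And>n::nat. nowhere_dense (N n)) \<Longrightarrow> M \<subseteq> (\<Union>n. N n) \<Longrightarrow> meager M"
  unfolding meager_def
  by (rule exI[of _ "\<lambda>n. N n \<inter> M"]) (auto intro: nowhere_dense_subset)

lemma nowhere_dense_imp_meager: "nowhere_dense N \<Longrightarrow> meager N"
  by (rule meagerI[of "\<lambda>_. N"]) auto

lemma meager_subset: "meager N \<Longrightarrow> M \<subseteq> N \<Longrightarrow> meager M"
  unfolding meager_def using meagerI meager_def by metis

lemma meager_empty [simp]: "meager {}"
  by (rule nowhere_dense_imp_meager) (simp add: nowhere_dense_def)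

lemma meager_UN_nat:
  assumes "\<And>n::nat. meager (M n)"
  shows "meager (\<Union>n. M n)"
proof -
  obtain N where N: "\<And>n k::nat. nowhere_dense (N n k)" "\<And>n. M n = (\<Union>k. N n k)"
    using assms unfolding meager_def by metis
  show ?thesis
  proof (rule meagerI)
    show "nowhere_dense (case prod_decode i of (n, k) \<Rightarrow> N n k)" for i
      by (simp add: N split: prod.split)
    show "(\<Union>n. M n) \<subseteq> (\<Union>i. case prod_decode i of (n, k) \<Rightarrow> N n k)"
      unfolding N by (auto intro!: exI[of _ "prod_encode (_, _)"])
  qed
qed

lemma meager_UN:
  assumes "countable I" "\<And>i. i \<in> I \<Longrightarrow> meager (M i)"
  shows "meager (\<Union>i\<in>I. M i)"
proof (cases "I = {}")
  case False
  have "(\<Union>i\<in>I. M i) = (\<Union>n. M (from_nat_into I n))"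
    using range_from_nat_into[OF False assms(1)] by (metis image_image)
  then show ?thesis
    using meager_UN_nat[of "\<lambda>n. M (from_nat_into I n)"] assms(2) from_nat_into[OF False] by simp
qed simp

lemma meager_Un: "meager A \<Longrightarrow> meager B \<Longrightarrow> meager (A \<union> B)"
  using meager_UN[of "{A, B}" "\<lambda>x. x"] by auto

text \<open>An open set inside the preimage of the closure of a nowhere dense set has an open image
  inside that closure, hence is empty.\<close>

lemma meager_vimage_open_map:
  fixes f :: "'a::topological_space \<Rightarrow> 'b::topological_space"
  assumes f: "continuous_on UNIV f" "\<And>V. open V \<Longrightarrow> open (f ` V)" and M: "meager M"
  shows "meager (f -` M)"
proof -
  obtain N where N: "\<And>n::nat. nowhere_dense (N n)" "M = (\<Union>n. N n)"
    using M unfolding meager_def by metis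
  have "nowhere_dense (f -` N n)" for n
  proof -
    let ?K = "f -` closure (N n)"
    have "closure (f -` N n) \<subseteq> ?K"
      by (rule closure_minimal) (use closure_subset in \<open>auto intro: closed_vimage f\<close>)
    moreover have "f ` interior ?K \<subseteq> interior (closure (N n))"
      by (rule interior_maximal) (use interior_subset in \<open>auto intro: f\<close>)
    ultimately show ?thesis
      using N(1)[of n] interior_mono unfolding nowhere_dense_def by blast
  qed
  then show ?thesis
    by (intro meagerI[of "\<lambda>n. f -` N n"]) (auto simp: N)
qed

lemma meager_vimage_homeomorphism:
  fixes f :: "'a::topological_space \<Rightarrow> 'b::topological_space"
  assumes "continuous_on UNIV f" "continuous_on UNIV g" "\<And>x. g (f x) = x" "\<And>y. f (g y) = y"
    and "meager M"
  shows "meager (f -` M)"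
proof (rule meager_vimage_open_map[OF assms(1)])
  have "f ` V = g -` V" for V
    using assms(3,4) by (auto simp: image_iff) (metis)
  then show "open (f ` V)" if "open V" for V
    using open_vimage[OF that assms(2)] by simp
qed fact

section \<open>Borel sets are open modulo meager sets\<close>

lemma meager_closed_diff_interior: "closed K \<Longrightarrow> meager (K - interior K)"
proof (rule nowhere_dense_imp_meager)
  assume K: "closed K"
  let ?D = "K - interior K"
  have "interior ?D \<subseteq> interior K" "interior ?D \<subseteq> ?D"
    by (rule interior_mono, blast) (rule interior_subset)
  then have "interior ?D = {}" by blast
  then show "nowhere_dense ?D"
    using K by (simp add: nowhere_dense_def closed_Diff)
qed

text \<open>The Baire property: sets that agree with an open set up to a meager set form a
  sigma-algebra. For complements the witness is the interior of \<open>- G\<close>, since a closed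
  set exceeds its interior only by a nowhere dense set.\<close>

lemma borel_eq_open_mod_meager:
  assumes "A \<in> sets borel"
  shows "\<exists>G. open G \<and> meager (A - G) \<and> meager (G - A)"
proof -
  have "A \<in> sigma_sets UNIV {S. open S}"
    using assms by (simp add: borel_def)
  then show ?thesis
  proof induction
    case (Basic A)
    then show ?case by (auto intro!: exI[of _ A])
  next
    case Empty
    then show ?case by (auto intro!: exI[of _ "{}"])
  next
    case (Compl A)
    then obtain G where G: "open G" "meager (A - G)" "meager (G - A)" by blast
    have "meager (- G - interior (- G))"
      using G by (intro meager_closed_diff_interior) auto
    moreover have "UNIV - A - interior (- G) \<subseteq> (G - A) \<union> (- G - interior (- G))"
      by blast
    ultimately have "meager (UNIV - A - interior (- G))"
      using G meager_Un meager_subset by blast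
    moreover have "meager (interior (- G) - (UNIV - A))"
      by (rule meager_subset[OF G(2)]) (use interior_subset in blast)
    ultimately show ?case by blast
  next
    case (Union A)
    then obtain G where G: "\<And>n. open (G n) \<and> meager (A n - G n) \<and> meager (G n - A n)" by metis
    have "meager (\<Union>n. A n - G n)" "meager (\<Union>n. G n - A n)"
      using G by (auto intro: meager_UN_nat)
    moreover have "(\<Union>n. A n) - (\<Union>n. G n) \<subseteq> (\<Union>n. A n - G n)"
      "(\<Union>n. G n) - (\<Union>n. A n) \<subseteq> (\<Union>n. G n - A n)" by auto
    ultimately have "meager ((\<Union>n. A n) - (\<Union>n. G n))" "meager ((\<Union>n. G n) - (\<Union>n. A n))"
      using meager_subset by blast+
    moreover have "open (\<Union>n. G n)" using G by blast
    ultimately show ?case by blast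
  qed
qed

lemma borel_nonmeager_comeager_in_open:
  assumes "A \<in> sets borel" "\<not> meager A"
  obtains G where "open G" "G \<noteq> {}" "meager (G - A)"
proof -
  obtain G where G: "open G" "meager (A - G)" "meager (G - A)"
    using borel_eq_open_mod_meager[OF assms(1)] by blast
  moreover have "G \<noteq> {}"
    using G assms(2) by auto
  ultimately show ?thesis using that by blast
qed

section \<open>Sections over finite tuples and the Kuratowski-Ulam theorem\<close>

definition prefix :: "'a list \<Rightarrow> (nat \<Rightarrow> 'a) \<Rightarrow> nat \<Rightarrow> 'a" where
  "prefix ps t = (\<lambda>i. if i < length ps then ps ! i else t (i - length ps))"

text \<open>The tail is indexed from \<open>0\<close> again, so a section lives in the same sequence
  space and sections can be iterated.\<close>

definition sect :: "(nat \<Rightarrow> 'a) set \<Rightarrow> 'a list \<Rightarrow> (nat \<Rightarrow> 'a) set" where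
  "sect M ps = {t. prefix ps t \<in> M}"

lemma prefix_append: "prefix (ps @ qs) t = prefix ps (prefix qs t)"
  by (auto simp: prefix_def fun_eq_iff nth_append)

lemma sect_append: "sect M (ps @ qs) = sect (sect M ps) qs"
  by (simp add: sect_def prefix_append)

lemma sect_Nil [simp]: "sect M [] = M"
  by (simp add: sect_def prefix_def)

lemma continuous_prefix:
  "continuous_on UNIV (\<lambda>t :: nat \<Rightarrow> 'a::topological_space. prefix ps t)"
proof (rule continuous_on_coordinatewise_then_product)
  show "continuous_on UNIV (\<lambda>t :: nat \<Rightarrow> 'a. prefix ps t i)" for i
    by (cases "i < length ps") (simp_all add: prefix_def)
qed

lemma continuous_prefix_singleton:
  "continuous_on UNIV (\<lambda>x :: 'a::topological_space. prefix [x] t)"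
proof (rule continuous_on_coordinatewise_then_product)
  show "continuous_on UNIV (\<lambda>x :: 'a. prefix [x] t i)" for i
    by (cases i) (simp_all add: prefix_def)
qed

lemma sect_borel:
  fixes M :: "(nat \<Rightarrow> 'a::topological_space) set"
  shows "M \<in> sets borel \<Longrightarrow> sect M ps \<in> sets borel"
  using measurable_sets_borel[OF borel_measurable_continuous_onI[OF continuous_prefix]]
  by (simp add: sect_def vimage_def)

lemma prefix_singleton_decomp: "prefix [t 0] (\<lambda>i. t (Suc i)) = t"
  by (auto simp: prefix_def fun_eq_iff)

lemma open_cylinder:
  fixes V :: "'a::topological_space set"
  assumes "open V" "open B"
  shows "open {t. t 0 \<in> V \<and> (\<lambda>i. t (Suc i)) \<in> B}"
proof -
  have "open ((\<lambda>t::nat\<Rightarrow>'a. t 0) -` V)" "open ((\<lambda>t i. t (Suc i)) -` B)"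
    using assms by (auto intro!: open_vimage continuous_on_coordinatewise_then_product)
  then have "open ((\<lambda>t. t 0) -` V \<inter> (\<lambda>t i. t (Suc i)) -` B)" by blast
  moreover have "(\<lambda>t. t 0) -` V \<inter> (\<lambda>t i. t (Suc i)) -` B = {t. t 0 \<in> V \<and> (\<lambda>i. t (Suc i)) \<in> B}"
    by auto
  ultimately show ?thesis by simp
qed

text \<open>For each tail, the heads completing it to a point of \<open>V\<close> form an open set;
  the image is the union of these sets over all tails.\<close>

lemma open_map_eval0:
  fixes V :: "(nat \<Rightarrow> 'a::topological_space) set"
  assumes "open V"
  shows "open ((\<lambda>t. t 0) ` V)"
proof -
  have "(\<lambda>t. t 0) ` V = (\<Union>t. (\<lambda>x. prefix [x] t) -` V)"
  proof (intro equalityI subsetI)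
    fix x assume "x \<in> (\<lambda>t. t 0) ` V"
    then obtain t where "t \<in> V" "x = t 0" by blast
    then have "prefix [x] (\<lambda>i. t (Suc i)) \<in> V" by (simp add: prefix_singleton_decomp)
    then show "x \<in> (\<Union>t. (\<lambda>x. prefix [x] t) -` V)" by blast
  next
    fix x assume "x \<in> (\<Union>t. (\<lambda>x. prefix [x] t) -` V)"
    then obtain t where "prefix [x] t \<in> V" by blast
    then show "x \<in> (\<lambda>t. t 0) ` V" by (auto simp: prefix_def intro!: rev_image_eqI)
  qed
  then show ?thesis
    using assms by (auto intro!: open_vimage continuous_prefix_singleton)
qed

text \<open>The easy half of the Kuratowski--Ulam theorem, for the decomposition of a sequence
  into its head and its tail.\<close>

lemma Kuratowski_Ulam_nowhere_dense:
  fixes A :: "(nat \<Rightarrow> 'a::second_countable_topology) set"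
  assumes "nowhere_dense A"
  shows "meager {x. \<not> nowhere_dense (sect A [x])}"
proof -
  obtain \<B> :: "(nat \<Rightarrow> 'a) set set" where \<B>: "countable \<B>" "topological_basis \<B>"
    using ex_countable_basis by blast
  \<comment> \<open>\<open>K B\<close> collects the heads over which \<open>closure A\<close>
    contains all of the basic set \<open>B\<close>. It is closed, and an interior point would put a
    whole cylinder into \<open>closure A\<close>. A head whose section is not nowhere dense lies in
    some \<open>K B\<close>.\<close>
  define K where "K B = {x. \<forall>t\<in>B. prefix [x] t \<in> closure A}" for B
  have K: "nowhere_dense (K B)" if "B \<in> \<B> - {{}}" for B
  proof -
    have B: "open B" "B \<noteq> {}" using that \<B> topological_basis_open by auto
    have "K B = (\<Inter>t\<in>B. (\<lambda>x. prefix [x] t) -` closure A)" by (auto simp: K_def)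
    then have "closed (K B)"
      by (auto intro!: closed_INT closed_vimage continuous_prefix_singleton)
    moreover have "interior (K B) = {}"
    proof (rule ccontr)
      assume "interior (K B) \<noteq> {}"
      then obtain x where x: "x \<in> interior (K B)" by blast
      obtain t where t: "t \<in> B" using B by blast
      let ?W = "{t. t 0 \<in> interior (K B) \<and> (\<lambda>i. t (Suc i)) \<in> B}"
      have "?W \<subseteq> closure A"
      proof
        fix t assume "t \<in> ?W"
        then have "t 0 \<in> K B" "(\<lambda>i. t (Suc i)) \<in> B" using interior_subset by blast+
        then have "prefix [t 0] (\<lambda>i. t (Suc i)) \<in> closure A"
          unfolding K_def by blast
        then show "t \<in> closure A" by (simp add: prefix_singleton_decomp)
      qed
      then have "?W \<subseteq> interior (closure A)"
        by (intro interior_maximal open_cylinder) (auto simp: B)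
      moreover have "prefix [x] t \<in> ?W" using x t by (simp add: prefix_def)
      ultimately show False using assms unfolding nowhere_dense_def by blast
    qed
    ultimately show ?thesis by (simp add: nowhere_dense_def)
  qed
  have "{x. \<not> nowhere_dense (sect A [x])} \<subseteq> (\<Union>B\<in>\<B> - {{}}. K B)"
  proof
    fix x assume "x \<in> {x. \<not> nowhere_dense (sect A [x])}"
    then have "interior (closure (sect A [x])) \<noteq> {}" by (simp add: nowhere_dense_def)
    then obtain t where "t \<in> interior (closure (sect A [x]))" by blast
    then obtain B where B: "B \<in> \<B>" "t \<in> B" "B \<subseteq> interior (closure (sect A [x]))"
      using topological_basisE[OF \<B>(2)] by (metis open_interior)
    have "closure (sect A [x]) \<subseteq> prefix [x] -` closure A"
      by (rule closure_minimal)
        (use closure_subset in \<open>auto simp: sect_def intro!: closed_vimage continuous_prefix\<close>)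
    then have "B \<subseteq> prefix [x] -` closure A" using B(3) interior_subset by blast
    then have "x \<in> K B" unfolding K_def by blast
    then show "x \<in> (\<Union>B\<in>\<B> - {{}}. K B)" using B by blast
  qed
  moreover have "meager (\<Union>B\<in>\<B> - {{}}. K B)"
    by (rule meager_UN) (auto simp: \<B> intro: nowhere_dense_imp_meager K)
  ultimately show ?thesis by (rule meager_subset[rotated])
qed

lemma Kuratowski_Ulam:
  fixes A :: "(nat \<Rightarrow> 'a::second_countable_topology) set"
  assumes "meager A"
  shows "meager {x. \<not> meager (sect A [x])}"
proof -
  obtain N where N: "\<And>n::nat. nowhere_dense (N n)" "A = (\<Union>n. N n)"
    using assms unfolding meager_def by metis
  have "{x. \<not> meager (sect A [x])} \<subseteq> (\<Union>n. {x. \<not> nowhere_dense (sect (N n) [x])})"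
  proof
    fix x assume x: "x \<in> {x. \<not> meager (sect A [x])}"
    show "x \<in> (\<Union>n. {x. \<not> nowhere_dense (sect (N n) [x])})"
    proof (rule ccontr)
      assume "x \<notin> (\<Union>n. {x. \<not> nowhere_dense (sect (N n) [x])})"
      then have "meager (sect A [x])"
        by (intro meagerI[of "\<lambda>n. sect (N n) [x]"]) (auto simp: N sect_def)
      then show False using x by simp
    qed
  qed
  moreover have "meager (\<Union>n. {x. \<not> nowhere_dense (sect (N n) [x])})"
    by (intro meager_UN_nat Kuratowski_Ulam_nowhere_dense N)
  ultimately show ?thesis by (rule meager_subset[rotated])
qed

section \<open>Covering by meager sets in Polish spaces\<close>

lemma lepoll_iff_card_of: "A \<lesssim> B \<longleftrightarrow> |A| \<le>o |B|"
  using card_of_ordLeq[of A B] by (simp add: lepoll_def)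

lemma lesspoll_iff_card_of: "A \<prec> B \<longleftrightarrow> |A| <o |B|"
  unfolding lesspoll_def lepoll_iff_card_of eqpoll_iff_card_of_ordIso ordLeq_iff_ordLess_or_ordIso
  using not_ordLess_ordIso[of "|A|" "|B|"] by blast

lemma lepoll_total: "A \<lesssim> B \<or> B \<lesssim> A"
  unfolding lepoll_iff_card_of by (rule ordLeq_total[OF card_of_Well_order card_of_Well_order])

lemma infinite_Times_self_lepoll: "infinite A \<Longrightarrow> A \<times> A \<lesssim> A"
  unfolding lepoll_iff_card_of by (rule ordIso_imp_ordLeq[OF card_of_Times_same_infinite])

lemma lesspoll_Times_self:
  assumes "A \<prec> C" "infinite C"
  shows "A \<times> A \<prec> C"
proof (cases "finite A")
  case True
  then show ?thesis using assms(2) by (simp add: finite_lesspoll_infinite)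
next
  case False
  then show ?thesis by (rule lesspoll_trans1[OF infinite_Times_self_lepoll assms(1)])
qed

lemma lesspoll_Times:
  assumes "A \<prec> C" "B \<prec> C" "infinite C"
  shows "A \<times> B \<prec> C"
  using lepoll_total[of A B]
proof
  assume "A \<lesssim> B"
  then show ?thesis
    by (rule lesspoll_trans1[OF times_lepoll_mono[OF _ lepoll_refl] lesspoll_Times_self[OF assms(2,3)]])
next
  assume "B \<lesssim> A"
  then show ?thesis
    by (rule lesspoll_trans1[OF times_lepoll_mono[OF lepoll_refl] lesspoll_Times_self[OF assms(1,3)]])
qed

lemma lesspoll_Un: "A \<prec> C \<Longrightarrow> B \<prec> C \<Longrightarrow> infinite C \<Longrightarrow> A \<union> B \<prec> C"
  unfolding lesspoll_iff_card_of by (rule card_of_Un_ordLess_infinite)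

lemma infinite_UNIV_real: "infinite (UNIV :: real set)"
  by (rule infinite_UNIV_char_0)

lemma countable_lesspoll_real:
  assumes "countable A"
  shows "A \<prec> (UNIV :: real set)"
proof -
  have "A \<lesssim> (UNIV :: real set)"
    using countable_lepoll[OF assms] uncountable_UNIV_real lepoll_total by blast
  moreover have "\<not> A \<approx> (UNIV :: real set)"
    using countable_lepoll[OF assms] uncountable_UNIV_real eqpoll_imp_lepoll eqpoll_sym by blast
  ultimately show ?thesis by (simp add: lesspoll_def)
qed

lemma image_lesspoll: "A \<prec> B \<Longrightarrow> f ` A \<prec> B"
  by (rule lesspoll_trans1[OF image_lepoll])

section \<open>From generic reals to generic points of a Polish space\<close>

lemma open_contains_closure:
  fixes V :: "'a::metric_space set"
  assumes "open V" "V \<noteq> {}"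
  shows "\<exists>V'. open V' \<and> V' \<noteq> {} \<and> closure V' \<subseteq> V"
proof -
  obtain x e where "x \<in> V" "e > 0" "cball x e \<subseteq> V"
    using assms open_contains_cball by blast
  then show ?thesis
    using closure_minimal[OF ball_subset_cball closed_cball, of x e]
    by (intro exI[of _ "ball x e"]) auto
qed

text \<open>The binary digits of \<open>r\<close> decide which members of the sequence \<open>C\<close> are used to shrink the
  open set \<open>W\<close>. For generic \<open>r\<close> the sets \<open>shrink C W r n\<close> converge to a generic point of \<open>W\<close>.\<close>

primrec shrink :: "(nat \<Rightarrow> 'a::topological_space set) \<Rightarrow> 'a set \<Rightarrow> real \<Rightarrow> nat \<Rightarrow> 'a set" where
  "shrink C W r 0 = W"
| "shrink C W r (Suc n) =
    (if odd \<lfloor>2 ^ Suc n * r\<rfloor> \<and> closure (C n) \<subseteq> shrink C W r n then C n else shrink C W r n)"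

lemma shrink_decreasing: "m \<le> n \<Longrightarrow> shrink C W r n \<subseteq> shrink C W r m"
proof (induction n rule: dec_induct)
  case (step n)
  then show ?case using closure_subset[of "C n"] by auto
qed simp

lemma shrink_open: "(\<And>n. open (C n)) \<Longrightarrow> open W \<Longrightarrow> open (shrink C W r n)"
  by (induction n) auto

lemma shrink_nonempty: "(\<And>n. C n \<noteq> {}) \<Longrightarrow> W \<noteq> {} \<Longrightarrow> shrink C W r n \<noteq> {}"
  by (induction n) auto

lemma floor_pow2_div:
  assumes "m \<le> n"
  shows "\<lfloor>2 ^ m * r :: real\<rfloor> = \<lfloor>2 ^ n * r\<rfloor> div 2 ^ (n - m)"
proof -
  have "2 ^ m * r = 2 ^ n * r / real_of_int (2 ^ (n - m))"
    using assms by (simp add: field_simps flip: power_add)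
  then show ?thesis
    using floor_divide_real_eq_div[of "2 ^ (n - m)" "2 ^ n * r"] by simp
qed

lemma shrink_cong:
  assumes "\<lfloor>2 ^ n * r\<rfloor> = \<lfloor>2 ^ n * s\<rfloor>" "m \<le> n"
  shows "shrink C W r m = shrink C W s m"
  using assms(2)
proof (induction m)
  case (Suc m)
  then have "\<lfloor>2 ^ Suc m * r\<rfloor> = \<lfloor>2 ^ Suc m * s\<rfloor>"
    using floor_pow2_div[of "Suc m" n] assms(1) by metis
  then show ?case using Suc by simp
qed simp

text \<open>\<open>D\<close> acts as a dense requirement on the shrinking process. Inside a given
  interval, the first \<open>n\<close> digits of \<open>a\<close> lead to the set \<open>V\<close>;
  appending zeros until some \<open>C k\<close> lies inside a good part of \<open>V\<close>, and
  then a one, gives a subinterval on which the process enters \<open>D\<close>.\<close>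

lemma nowhere_dense_shrink_avoids:
  fixes C :: "nat \<Rightarrow> 'a::metric_space set"
  assumes C: "\<And>n. open (C n)" "\<And>n. C n \<noteq> {}"
    and basis: "\<And>V n. open V \<Longrightarrow> V \<noteq> {} \<Longrightarrow> \<exists>k\<ge>n. closure (C k) \<subseteq> V"
    and W: "open W" "W \<noteq> {}"
    and D: "\<And>V. open V \<Longrightarrow> V \<noteq> {} \<Longrightarrow> \<exists>V'. open V' \<and> V' \<noteq> {} \<and> V' \<subseteq> V \<and> (\<forall>V''\<subseteq>V'. V'' \<in> D)"
  shows "nowhere_dense {r. \<forall>n. shrink C W r n \<notin> D}"
proof -
  let ?S = "{r. \<forall>n. shrink C W r n \<notin> D}"
  have dense: "\<exists>J'. open J' \<and> J' \<noteq> {} \<and> J' \<subseteq> J - ?S" if J: "open J" "J \<noteq> {}" for J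
  proof -
    obtain a e where ae: "a \<in> J" "e > 0" "ball a e \<subseteq> J"
      using J open_contains_ball by blast
    obtain n where n: "(1/2) ^ n < e"
      using real_arch_pow_inv[OF ae(2), of "1/2"] by auto
    define i where "i = \<lfloor>2 ^ n * a\<rfloor>"
    define V where "V = shrink C W a n"
    have "open V" "V \<noteq> {}"
      using shrink_open[OF C(1) W(1)] shrink_nonempty[OF C(2) W(2)] by (auto simp: V_def)
    then obtain V' where V': "open V'" "V' \<noteq> {}" "V' \<subseteq> V" "\<forall>V''\<subseteq>V'. V'' \<in> D"
      using D by metis
    obtain k where k: "k \<ge> n" "closure (C k) \<subseteq> V'"
      using basis[OF V'(1,2)] by blast
    \<comment> \<open>In binary, \<open>j\<close> is \<open>i\<close> followed by zeros up to place
      \<open>k\<close> and a one at place \<open>Suc k\<close>, the place that decides on the use of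
      \<open>C k\<close>.\<close>
    define j where "j = i * 2 ^ (Suc k - n) + 1"
    have j_div: "j div 2 ^ (Suc k - m) = i * 2 ^ (m - n)" if "n \<le> m" "m \<le> k" for m
    proof -
      have "Suc k - n = (m - n) + (Suc k - m)" using that k by simp
      then have "j = 1 + i * 2 ^ (m - n) * 2 ^ (Suc k - m)"
        by (simp add: j_def power_add)
      moreover have "(1::int) < 2 ^ (Suc k - m)"
        using that by (intro one_less_power) auto
      ultimately show ?thesis using that by (simp add: div_add1_eq)
    qed
    have main: "r \<in> J \<and> shrink C W r (Suc k) \<in> D" if r: "\<lfloor>2 ^ Suc k * r\<rfloor> = j" for r
    proof -
      have ri: "\<lfloor>2 ^ m * r\<rfloor> = i * 2 ^ (m - n)" if "n \<le> m" "m \<le> k" for m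
        using floor_pow2_div[of m "Suc k" r] r j_div[OF that] that by simp
      have rn: "\<lfloor>2 ^ n * r\<rfloor> = \<lfloor>2 ^ n * a\<rfloor>" using ri[of n] k by (simp add: i_def)
      then have "\<bar>2 ^ n * r - 2 ^ n * a\<bar> < 1" by linarith
      then have "2 ^ n * \<bar>r - a\<bar> < 1"
        by (metis abs_mult abs_numeral power_abs right_diff_distrib)
      then have "\<bar>r - a\<bar> < (1/2) ^ n"
        by (simp add: field_simps)
      then have "r \<in> J" using ae n by (auto simp: dist_real_def subset_iff)
      moreover have "shrink C W r m = V" if "n \<le> m" "m \<le> k" for m
        using that
      proof (induction m rule: dec_induct)
        case base
        show ?case unfolding V_def by (rule shrink_cong[OF rn]) simp
      next
        case (step m)
        have "\<not> odd \<lfloor>2 ^ Suc m * r\<rfloor>" using ri[of "Suc m"] step.hyps step.prems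
          by (simp add: Suc_diff_le)
        then show ?case using step by (simp del: power_Suc)
      qed
      then have "shrink C W r k = V" using k by simp
      moreover have "odd j" using k by (simp add: j_def)
      ultimately have "shrink C W r (Suc k) = C k"
        using k(2) V'(3) r by (simp del: power_Suc) blast
      then show ?thesis using \<open>r \<in> J\<close> V'(4) k(2) closure_subset by blast
    qed
    let ?J = "{of_int j / 2 ^ Suc k <..< (of_int j + 1) / 2 ^ Suc k :: real}"
    have "\<lfloor>2 ^ Suc k * r\<rfloor> = j" if "r \<in> ?J" for r
      using that by (intro floor_unique) (auto simp: field_simps)
    then have "?J \<subseteq> J - ?S" using main by blast
    moreover have "of_int j / 2 ^ Suc k < (of_int j + 1) / (2 ^ Suc k :: real)"
      by (rule divide_strict_right_mono) auto
    then have "?J \<noteq> {}" by simp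
    ultimately show ?thesis by (metis open_greaterThanLessThan)
  qed
  have "interior (closure ?S) = {}"
  proof (rule ccontr)
    assume "interior (closure ?S) \<noteq> {}"
    then obtain J' where J': "open J'" "J' \<noteq> {}" "J' \<subseteq> interior (closure ?S) - ?S"
      using dense[OF open_interior] by blast
    then have "J' \<inter> closure ?S = {}"
      using open_Int_closure_eq_empty[OF J'(1), of ?S] by blast
    then show False using J' interior_subset by blast
  qed
  then show ?thesis by (simp add: nowhere_dense_def)
qed

lemma shrink_sequence_exists:
  "\<exists>C :: nat \<Rightarrow> 'a::{metric_space,second_countable_topology} set.
    (\<forall>n. open (C n) \<and> C n \<noteq> {}) \<and> (\<forall>V n. open V \<longrightarrow> V \<noteq> {} \<longrightarrow> (\<exists>k\<ge>n. closure (C k) \<subseteq> V))"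
proof -
  obtain \<B> :: "'a set set" where \<B>: "countable \<B>" "topological_basis \<B>"
    using ex_countable_basis by blast
  let ?\<B> = "\<B> - {{}}"
  have count: "countable ?\<B>" using \<B> by simp
  have basis: "\<exists>B\<in>?\<B>. closure B \<subseteq> V" if V: "open V" "V \<noteq> {}" for V
  proof -
    obtain V' where V': "open V'" "V' \<noteq> {}" "closure V' \<subseteq> V"
      using open_contains_closure[OF V] by blast
    then obtain x where "x \<in> V'" by blast
    then obtain B where "B \<in> \<B>" "x \<in> B" "B \<subseteq> V'"
      using topological_basisE[OF \<B>(2) V'(1)] by metis
    then show ?thesis using V'(3) closure_mono[of B V'] by blast
  qed
  then have ne: "?\<B> \<noteq> {}" by (metis UNIV_not_empty empty_iff open_UNIV)
  \<comment> \<open>The index is read as a pair whose second component is free, so every basic set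
    recurs at arbitrarily large indices.\<close>
  define C where "C n = from_nat_into ?\<B> (fst (prod_decode n))" for n
  have "open (C n) \<and> C n \<noteq> {}" for n
    using from_nat_into[OF ne] topological_basis_open[OF \<B>(2)] by (auto simp: C_def)
  moreover have "\<exists>k\<ge>n. closure (C k) \<subseteq> V" if V: "open V" "V \<noteq> {}" for V n
  proof -
    obtain B where B: "B \<in> ?\<B>" "closure B \<subseteq> V" using basis[OF V] by blast
    then obtain i where "from_nat_into ?\<B> i = B" using from_nat_into_surj[OF count] by blast
    then have "closure (C (prod_encode (i, n))) \<subseteq> V" using B by (simp add: C_def)
    then show ?thesis using le_prod_encode_2 by blast
  qed
  ultimately show ?thesis by blast
qed

text \<open>\<open>D1\<close> requires the shrinking sets to leave one nowhere dense piece of one of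
  the given meager sets, \<open>D2\<close> requires them to become small. There are fewer than
  continuum many such requirements, each failing only on a nowhere dense set of reals, so some
  \<open>r\<close> meets them all, and its shrinking sets converge to a point outside all the meager
  sets.\<close>

lemma cov_meager_polish:
  fixes W' :: "'a::polish_space set"
  assumes cov: "cov_meager_eq_continuum"
    and \<M>: "\<M> \<prec> (UNIV :: real set)" "\<And>M. M \<in> \<M> \<Longrightarrow> meager M"
    and W': "open W'" "W' \<noteq> {}"
  shows "\<not> W' \<subseteq> \<Union>\<M>"
proof -
  \<comment> \<open>The limit point is only known to lie in the closure of the initial set, hence
    the passage to \<open>W\<close>.\<close>
  obtain W where W: "open W" "W \<noteq> {}" "closure W \<subseteq> W'"
    using open_contains_closure[OF W'] by blast
  obtain C :: "nat \<Rightarrow> 'a set" where C: "\<And>n. open (C n)" "\<And>n. C n \<noteq> {}"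
    and basis: "\<And>V n. open V \<Longrightarrow> V \<noteq> {} \<Longrightarrow> \<exists>k\<ge>n. closure (C k) \<subseteq> V"
    using shrink_sequence_exists by metis
  obtain N where N: "\<And>M n::nat. M \<in> \<M> \<Longrightarrow> nowhere_dense (N M n)" "\<And>M. M \<in> \<M> \<Longrightarrow> M = (\<Union>n. N M n)"
    using \<M>(2) unfolding meager_def by metis
  define bad where "bad D = {r. \<forall>n. shrink C W r n \<notin> D}" for D
  define D1 where "D1 = (\<lambda>(M, n). {V. closure V \<inter> N M n = {}})"
  define D2 where "D2 j = {V. \<exists>x :: 'a. V \<subseteq> ball x (1 / real (Suc j))}" for j :: nat
  have nd: "nowhere_dense (bad D)"
    if "\<And>V. open V \<Longrightarrow> V \<noteq> {} \<Longrightarrow> \<exists>V'. open V' \<and> V' \<noteq> {} \<and> V' \<subseteq> V \<and> (\<forall>V''\<subseteq>V'. V'' \<in> D)" for D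
    unfolding bad_def by (rule nowhere_dense_shrink_avoids[OF C basis W(1,2) that])
  have 1: "nowhere_dense (bad (D1 (M, n)))" if M: "M \<in> \<M>" for M n
  proof (rule nd)
    fix V :: "'a set" assume V: "open V" "V \<noteq> {}"
    have "\<not> V \<subseteq> closure (N M n)"
      using N(1)[OF M, of n] V interior_maximal unfolding nowhere_dense_def by blast
    then obtain V' where V': "open V'" "V' \<noteq> {}" "closure V' \<subseteq> V - closure (N M n)"
      using open_contains_closure[of "V - closure (N M n)"] V by auto
    have "V'' \<in> D1 (M, n)" if "V'' \<subseteq> V'" for V''
      using V'(3) closure_mono[OF that] closure_subset[of "N M n"] by (auto simp: D1_def)
    moreover have "V' \<subseteq> V" using V'(3) closure_subset by blast
    ultimately show "\<exists>V'. open V' \<and> V' \<noteq> {} \<and> V' \<subseteq> V \<and> (\<forall>V''\<subseteq>V'. V'' \<in> D1 (M, n))"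
      using V' by blast
  qed
  have 2: "nowhere_dense (bad (D2 j))" for j
  proof (rule nd)
    fix V :: "'a set" assume V: "open V" "V \<noteq> {}"
    then obtain x where x: "x \<in> V" by blast
    let ?V = "V \<inter> ball x (1 / real (Suc j))"
    have "open ?V" using V by blast
    moreover have "x \<in> ?V" using x by simp
    moreover have "\<forall>V''\<subseteq>?V. V'' \<in> D2 j" unfolding D2_def by blast
    ultimately show "\<exists>V'. open V' \<and> V' \<noteq> {} \<and> V' \<subseteq> V \<and> (\<forall>V''\<subseteq>V'. V'' \<in> D2 j)"
      by blast
  qed
  define \<N> where "\<N> = (\<lambda>p. bad (D1 p)) ` (\<M> \<times> UNIV) \<union> range (\<lambda>j. bad (D2 j))"
  have "\<M> \<times> (UNIV :: nat set) \<prec> (UNIV :: real set)"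
    using \<M>(1) by (rule lesspoll_Times) (simp_all add: countable_lesspoll_real infinite_UNIV_real)
  then have "\<N> \<prec> (UNIV :: real set)"
    unfolding \<N>_def
    by (intro lesspoll_Un image_lesspoll) (simp_all add: countable_lesspoll_real infinite_UNIV_real)
  moreover have "\<forall>M\<in>\<N>. meager M"
    using 1 2 by (auto simp: \<N>_def intro: nowhere_dense_imp_meager)
  ultimately obtain r where r: "r \<notin> \<Union>\<N>"
    using cov unfolding cov_meager_eq_continuum_def by blast
  let ?V = "shrink C W r"
  have r1: "\<exists>k. closure (?V k) \<inter> N M n = {}" if "M \<in> \<M>" for M n
  proof -
    have "r \<notin> bad (D1 (M, n))" using r that by (auto simp: \<N>_def)
    then show ?thesis by (simp add: bad_def D1_def)
  qed
  have r2: "\<exists>k x. ?V k \<subseteq> ball x (1 / real (Suc j))" for j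
  proof -
    have "r \<notin> bad (D2 j)" using r by (auto simp: \<N>_def)
    then show ?thesis by (simp add: bad_def D2_def)
  qed
  have "\<forall>n. \<exists>x. x \<in> ?V n"
    using shrink_nonempty[of C, OF C(2) W(2)] by (simp add: ex_in_conv)
  then obtain x where x: "\<And>n. x n \<in> ?V n" by metis
  have "Cauchy x"
  proof (rule metric_CauchyI)
    fix e :: real assume "e > 0"
    then obtain j where j: "1 / real (Suc j) < e / 2"
      using reals_Archimedean[of "e/2"] by (auto simp: field_simps)
    obtain k y where ky: "?V k \<subseteq> ball y (1 / real (Suc j))" using r2 by blast
    have "dist (x m) (x n) < e" if "m \<ge> k" "n \<ge> k" for m n
    proof -
      have "x m \<in> ball y (1 / real (Suc j))" "x n \<in> ball y (1 / real (Suc j))"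
        using x shrink_decreasing[OF that(1)] shrink_decreasing[OF that(2)] ky by blast+
      then have "dist y (x m) < e/2" "dist y (x n) < e/2" using j by auto
      then show ?thesis by (metis dist_commute dist_triangle_half_l)
    qed
    then show "\<exists>M. \<forall>m\<ge>M. \<forall>n\<ge>M. dist (x m) (x n) < e" by blast
  qed
  then obtain l where l: "x \<longlonglongrightarrow> l" using Cauchy_convergent convergent_def by blast
  have lV: "l \<in> closure (?V k)" for k
  proof (rule Lim_in_closed_set[OF closed_closure _ _ l])
    show "\<forall>\<^sub>F n in sequentially. x n \<in> closure (?V k)"
      using x shrink_decreasing closure_subset
      by (intro eventually_sequentiallyI[of k]) blast
  qed simp
  have "l \<notin> \<Union>\<M>"
  proof
    assume "l \<in> \<Union>\<M>"
    then obtain M n where "M \<in> \<M>" "l \<in> N M n" using N(2) by blast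
    then show False using lV r1[of M n] by blast
  qed
  moreover have "l \<in> W'" using lV[of 0] W(3) by auto
  ultimately show ?thesis by blast
qed

section \<open>Sets of size continuum\<close>

text \<open>On an infinite \<open>A\<close> a pairing function folds a list into one element of
  \<open>A\<close>; the list is recovered from this code and its length.\<close>

lemma lists_lesspoll_real:
  assumes "A \<prec> (UNIV :: real set)"
  shows "lists A \<prec> (UNIV :: real set)"
proof (cases "finite A")
  case True
  then show ?thesis by (intro countable_lesspoll_real countable_lists countable_finite)
next
  case False
  then obtain p where p: "inj_on p (A \<times> A)" "p ` (A \<times> A) \<subseteq> A"
    using infinite_Times_self_lepoll[of A] unfolding lepoll_def by metis
  obtain a where a: "a \<in> A" using False by fastforce
  define enc where "enc = rec_list a (\<lambda>x xs r. p (x, r))"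
  have enc [simp]: "enc [] = a" "enc (x # xs) = p (x, enc xs)" for x xs
    by (simp_all add: enc_def)
  have enc_in: "enc xs \<in> A" if "xs \<in> lists A" for xs
    using that by induction (use a p in auto)
  have "xs = ys" if "xs \<in> lists A" "ys \<in> lists A" "length xs = length ys" "enc xs = enc ys" for xs ys
    using that(3,1,2,4)
  proof (induction xs ys rule: list_induct2)
    case (Cons x xs y ys)
    then have "(x, enc xs) = (y, enc ys)"
      using inj_onD[OF p(1), of "(x, enc xs)" "(y, enc ys)"] Cons.prems enc_in by auto
    then show ?case using Cons by simp
  qed simp
  then have "inj_on (\<lambda>xs. (length xs, enc xs)) (lists A)" by (auto intro!: inj_onI)
  then have "lists A \<lesssim> (UNIV :: nat set) \<times> A"
    unfolding lepoll_def using enc_in by (intro exI[of _ "\<lambda>xs. (length xs, enc xs)"]) auto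
  also have "(UNIV :: nat set) \<times> A \<prec> (UNIV :: real set)"
    by (rule lesspoll_Times[OF _ assms]) (simp_all add: countable_lesspoll_real infinite_UNIV_real)
  finally show ?thesis .
qed

lemma countable_fun_lepoll_real:
  "(UNIV :: ('a::countable \<Rightarrow> 'b::countable) set) \<lesssim> (UNIV :: real set)"
proof -
  have "inj (\<lambda>f :: 'a \<Rightarrow> 'b. range (\<lambda>x. to_nat (x, f x)))"
  proof (rule injI)
    fix f h :: "'a \<Rightarrow> 'b"
    assume eq: "range (\<lambda>x. to_nat (x, f x)) = range (\<lambda>x. to_nat (x, h x))"
    show "f = h"
    proof
      fix x
      have "to_nat (x, f x) \<in> range (\<lambda>x. to_nat (x, h x))" unfolding eq[symmetric] by blast
      then show "f x = h x" by auto
    qed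
  qed
  then have "(UNIV :: ('a \<Rightarrow> 'b) set) \<lesssim> (UNIV :: nat set set)"
    unfolding lepoll_def by blast
  then show ?thesis by (rule lepoll_trans2[OF _ nat_sets_eqpoll_reals])
qed

text \<open>Members of \<open>A\<close> are coded by sets of naturals, and pairing merges countably
  many codes into one.\<close>

lemma sequences_lepoll_real:
  assumes "A \<lesssim> (UNIV :: real set)"
  shows "{f :: nat \<Rightarrow> 'a. range f \<subseteq> A} \<lesssim> (UNIV :: real set)"
proof -
  have "A \<lesssim> (UNIV :: nat set set)"
    by (rule lepoll_trans2[OF assms eqpoll_sym[OF nat_sets_eqpoll_reals]])
  then obtain h :: "'a \<Rightarrow> nat set" where h: "inj_on h A"
    unfolding lepoll_def by blast
  define s where "s f = {prod_encode (n, k) | n k. k \<in> h (f n)}" for f :: "nat \<Rightarrow> 'a"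
  have "inj_on s {f. range f \<subseteq> A}"
  proof (rule inj_onI)
    fix f f' assume f: "f \<in> {f. range f \<subseteq> A}" "f' \<in> {f. range f \<subseteq> A}" "s f = s f'"
    have mem: "prod_encode (n, k) \<in> s f \<longleftrightarrow> k \<in> h (f n)" for f n k by (auto simp: s_def)
    have "h (f n) = h (f' n)" for n using mem f(3) by blast
    then have "f n = f' n" for n using f(1,2) by (intro inj_onD[OF h, of "f n" "f' n"]) auto
    then show "f = f'" by blast
  qed
  then have "{f :: nat \<Rightarrow> 'a. range f \<subseteq> A} \<lesssim> (UNIV :: nat set set)"
    unfolding lepoll_def by blast
  then show ?thesis by (rule lepoll_trans2[OF _ nat_sets_eqpoll_reals])
qed

lemma Times_lepoll_real:
  assumes "A \<lesssim> (UNIV :: real set)" "B \<lesssim> (UNIV :: real set)"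
  shows "A \<times> B \<lesssim> (UNIV :: real set)"
  by (rule lepoll_trans[OF times_lepoll_mono[OF assms] infinite_Times_self_lepoll[OF infinite_UNIV_real]])

section \<open>Borel codes and the number of Borel sets\<close>

text \<open>A Borel code is a well-founded tree, represented by labels of its finite branches; the label
  at the root tells how the set is built from the sets coded by the immediate subtrees.\<close>

inductive borel_code :: "(nat \<Rightarrow> 'a set) \<Rightarrow> (nat list \<Rightarrow> nat) \<Rightarrow> 'a set \<Rightarrow> bool" for B where
  basic: "c [] = 0 \<Longrightarrow> borel_code B c (B (c [0]))"
| empty: "c [] = 1 \<Longrightarrow> borel_code B c {}"
| compl: "c [] = 2 \<Longrightarrow> borel_code B (\<lambda>l. c (0 # l)) S \<Longrightarrow> borel_code B c (UNIV - S)"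
| union: "c [] = 3 \<Longrightarrow> (\<And>n. borel_code B (\<lambda>l. c (n # l)) (S n)) \<Longrightarrow> borel_code B c (\<Union>n. S n)"

lemma borel_code_unique:
  assumes "borel_code B c S" "borel_code B c S'"
  shows "S = S'"
  using assms
proof (induction arbitrary: S')
  case (basic c)
  from basic.prems basic.hyps show ?case by cases simp_all
next
  case (empty c)
  from empty.prems empty.hyps show ?case by cases simp_all
next
  case (compl c S)
  from compl.prems show ?case
  proof cases
    case (compl S'')
    then show ?thesis using \<open>\<And>S'. borel_code B (\<lambda>l. c (0 # l)) S' \<Longrightarrow> S = S'\<close> by blast
  qed (use compl.hyps in simp_all)
next
  case (union c S)
  from union.prems show ?case
  proof cases
    case (union S'')
    then have "S n = S'' n" for n
      using \<open>\<And>n S'. borel_code B (\<lambda>l. c (n # l)) S' \<Longrightarrow> S n = S'\<close> by blast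
    then show ?thesis using union by simp
  qed (use union.hyps in simp_all)
qed

lemma borel_code_exists:
  assumes "S \<in> sigma_sets UNIV (range B)"
  shows "\<exists>c. borel_code B c S"
  using assms
proof induction
  case (Basic S)
  then obtain n where "S = B n" by blast
  then show ?case
    using borel_code.basic[of "\<lambda>l. if l = [] then 0 else n"] by auto
next
  case Empty
  show ?case using borel_code.empty[of "\<lambda>_. 1"] by blast
next
  case (Compl S)
  then obtain c where "borel_code B c S" by blast
  then show ?case
    using borel_code.compl[of "\<lambda>l. case l of [] \<Rightarrow> 2 | _ # l \<Rightarrow> c l"] by auto
next
  case (Union S)
  then obtain c where "\<And>n. borel_code B (c n) (S n)" by metis
  then show ?case
    using borel_code.union[of "\<lambda>l. case l of [] \<Rightarrow> 3 | n # l \<Rightarrow> c n l"] by auto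
qed

text \<open>Every Borel set gets a code over a countable base, and a code determines its set. Codes
  are functions between countable types, so there are at most continuum many.\<close>

lemma borel_lepoll_real:
  "sets (borel :: 'a::second_countable_topology measure) \<lesssim> (UNIV :: real set)"
proof -
  obtain \<B> :: "'a set set" where \<B>: "countable \<B>" "topological_basis \<B>"
    using ex_countable_basis by blast
  have ne: "\<B> \<noteq> {}"
    using topological_basisE[OF \<B>(2) open_UNIV, of undefined] by blast
  define B where "B = from_nat_into \<B>"
  have "sets (borel :: 'a measure) = sets (sigma UNIV \<B>)"
    by (rule arg_cong[OF borel_eq_countable_basis[OF \<B>]])
  also have "\<dots> = sigma_sets UNIV \<B>" by (rule sets_measure_of) simp
  also have "\<B> = range B"
    unfolding B_def by (rule range_from_nat_into[OF ne \<B>(1), symmetric])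
  finally have sets: "sets (borel :: 'a measure) = sigma_sets UNIV (range B)" .
  have "\<exists>c. borel_code B c S" if "S \<in> sets borel" for S
    using borel_code_exists that unfolding sets by blast
  then obtain code where code: "\<And>S. S \<in> sets borel \<Longrightarrow> borel_code B (code S) S"
    by metis
  have "inj_on code (sets borel)"
  proof (rule inj_onI)
    fix S S' :: "'a set"
    assume "S \<in> sets borel" "S' \<in> sets borel" "code S = code S'"
    then show "S = S'" using borel_code_unique[OF code[of S], of S'] code[of S'] by simp
  qed
  then have "sets (borel :: 'a measure) \<lesssim> (UNIV :: (nat list \<Rightarrow> nat) set)"
    unfolding lepoll_def by blast
  then show ?thesis by (rule lepoll_trans[OF _ countable_fun_lepoll_real])
qed

text \<open>The order is the cardinal of the reals itself, whose proper initial segments all have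
  smaller cardinality.\<close>

lemma continuum_wellorder_exists:
  "\<exists>lt :: real \<Rightarrow> real \<Rightarrow> bool. wfP lt \<and> transp lt \<and> totalp lt \<and> (\<forall>a. {b. lt b a} \<prec> (UNIV :: real set))"
proof -
  let ?r = "card_of (UNIV :: real set)"
  define lt where "lt b a \<longleftrightarrow> (b, a) \<in> ?r - Id" for a b
  have wo: "well_order_on UNIV ?r" by (rule card_of_well_order_on)
  have lin: "linear_order_on UNIV ?r" and wf: "wf (?r - Id)"
    using wo by (auto simp: well_order_on_def)
  have "{(b, a). lt b a} = ?r - Id" by (auto simp: lt_def)
  then have "wfP lt" using wf by (simp add: wfp_def)
  moreover have "transp lt"
  proof (rule transpI)
    fix a b c assume "lt a b" "lt b c"
    moreover have "trans ?r" "antisym ?r"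
      using lin by (auto simp: linear_order_on_def partial_order_on_def preorder_on_def)
    ultimately show "lt a c"
      using transD[of ?r a b c] antisymD[of ?r a b] by (auto simp: lt_def)
  qed
  moreover have "totalp lt"
    using lin by (auto simp: lt_def totalp_on_def linear_order_on_def total_on_def)
  moreover have "{b. lt b a} \<prec> (UNIV :: real set)" for a
  proof -
    have "{b. lt b a} = underS ?r a" by (auto simp: lt_def underS_def)
    moreover have "a \<in> Field ?r" by (simp add: Field_card_of)
    ultimately show ?thesis
      using card_of_underS[OF card_of_Card_order, of a "UNIV :: real set"] by (simp add: lesspoll_iff_card_of)
  qed
  ultimately show ?thesis by blast
qed

section \<open>Generic sequences and the Luzin property\<close>

type_synonym rseq = "nat \<Rightarrow> real"

text \<open>Coefficients form a finite list, so there are only countably many forms; the argument is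
  a whole sequence, so each form is a continuous map on one fixed sequence space.\<close>

definition lin :: "rat list \<Rightarrow> (nat \<Rightarrow> rseq) \<Rightarrow> rseq" where
  "lin q t = (\<lambda>n. \<Sum>i<length q. of_rat (q ! i) * t i n)"

lemma lin_cong: "(\<And>i. i < length q \<Longrightarrow> q ! i = 0 \<or> t i = t' i) \<Longrightarrow> lin q t = lin q t'"
proof (unfold lin_def, intro ext sum.cong refl)
  fix n i
  assume "\<And>i. i < length q \<Longrightarrow> q ! i = 0 \<or> t i = t' i" "i \<in> {..<length q}"
  then have "q ! i = 0 \<or> t i = t' i" by blast
  then show "of_rat (q ! i) * t i n = of_rat (q ! i) * t' i n" by auto
qed

lemma lin_Nil [simp]: "lin [] t = 0"
  by (simp add: lin_def fun_eq_iff)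

lemma lin_snoc: "lin (q @ [x]) t = lin q t + rat_scale x (t (length q))"
proof
  fix n
  have "(\<Sum>i<length q. of_rat ((q @ [x]) ! i) * t i n) = (\<Sum>i<length q. of_rat (q ! i) * t i n)"
    by (rule sum.cong) (simp_all add: nth_append)
  then show "lin (q @ [x]) t n = (lin q t + rat_scale x (t (length q))) n"
    unfolding lin_def rat_scale_def plus_fun_apply length_append_singleton sum.lessThan_Suc
    by simp
qed

lemma continuous_coordinate2:
  "continuous_on UNIV (\<lambda>t :: 'i \<Rightarrow> 'j \<Rightarrow> 'a::topological_space. t i n)"
  by (rule continuous_on_product_then_coordinatewise[OF continuous_on_product_coordinates])

lemma continuous_lin: "continuous_on UNIV (lin q)"
  unfolding lin_def
  by (rule continuous_on_coordinatewise_then_product)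
    (intro continuous_on_sum continuous_on_mult_left continuous_coordinate2)

lemma lin_in_span:
  assumes "\<And>i. i < length q \<Longrightarrow> q ! i = 0 \<or> t i \<in> S"
  shows "lin q t \<in> rat_fun.span S"
  using assms
proof (induction q rule: rev_induct)
  case Nil
  show ?case by (subst lin_Nil) (rule rat_fun.span_zero)
next
  case (snoc x q)
  have "q ! i = 0 \<or> t i \<in> S" if "i < length q" for i
    using snoc.prems[of i] that by (simp add: nth_append)
  then have "lin q t \<in> rat_fun.span S" by (rule snoc.IH)
  moreover have "rat_scale x (t (length q)) \<in> rat_fun.span S"
    using snoc.prems[of "length q"]
    by (auto simp: rat_fun.span_zero intro: rat_fun.span_scale rat_fun.span_base)
  ultimately show ?case unfolding lin_snoc by (rule rat_fun.span_add)
qed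

text \<open>Allows one list of indices to serve several vectors. It may contain indices outside the
  support, such as that of a selector, which then receive coefficient zero.\<close>

lemma span_image_imp_lin:
  assumes "v \<in> rat_fun.span (g ` A)" "A \<subseteq> set cs"
  shows "\<exists>q. length q = length cs \<and> (\<forall>i<length cs. cs ! i \<notin> A \<longrightarrow> q ! i = 0) \<and>
    v = lin q (prefix (map g cs) t)"
  using assms(1)
proof (induction rule: rat_fun.span_induct_alt)
  case base
  show ?case
    by (rule exI[of _ "replicate (length cs) 0"]) (simp add: lin_def fun_eq_iff)
next
  case (step c x y)
  obtain q where q: "length q = length cs" "\<forall>i<length cs. cs ! i \<notin> A \<longrightarrow> q ! i = 0"
    "y = lin q (prefix (map g cs) t)" using step.IH by blast
  obtain a where a: "a \<in> A" "x = g a" using step.hyps by blast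
  then obtain k where k: "k < length cs" "cs ! k = a"
    using assms(2) by (metis in_mono in_set_conv_nth)
  define q' where "q' = q[k := q ! k + c]"
  have "rat_scale c x + y = lin q' (prefix (map g cs) t)"
  proof
    fix n
    let ?t = "prefix (map g cs) t"
    have "lin q' ?t n = (\<Sum>i<length cs. of_rat (q ! i) * ?t i n + (if i = k then of_rat c * ?t k n else 0))"
      unfolding lin_def q'_def using q(1) k
      by (intro sum.cong) (auto simp: nth_list_update of_rat_add algebra_simps)
    also have "\<dots> = y n + of_rat c * ?t k n"
      using k q by (simp add: sum.distrib lin_def)
    also have "?t k = x" using k a by (simp add: prefix_def)
    finally show "(rat_scale c x + y) n = lin q' ?t n" by (simp add: rat_scale_def)
  qed
  moreover have "length q' = length cs" "\<forall>i<length cs. cs ! i \<notin> A \<longrightarrow> q' ! i = 0"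
    using q k a by (auto simp: q'_def nth_list_update)
  ultimately show ?case by blast
qed

lemma meager_borel_hull:
  assumes "meager M"
  obtains M' where "M \<subseteq> M'" "M' \<in> sets borel" "meager M'"
proof -
  obtain N where N: "\<And>n::nat. nowhere_dense (N n)" "M = (\<Union>n. N n)"
    using assms unfolding meager_def by metis
  show thesis
  proof
    show "M \<subseteq> (\<Union>n. closure (N n))" using N(2) closure_subset by blast
    show "(\<Union>n. closure (N n)) \<in> sets borel"
      by (intro sets.countable_UN'' borel_closed closed_closure) simp
    show "meager (\<Union>n. closure (N n))"
      using N(1) by (intro meager_UN_nat nowhere_dense_imp_meager) (simp add: nowhere_dense_def)
  qed
qed

lemma meager_singleton: "meager {c :: rseq}"
proof -
  have "meager {c 0}"
    by (intro nowhere_dense_imp_meager) (simp add: nowhere_dense_def)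
  then have "meager ((\<lambda>x :: rseq. x 0) -` {c 0})"
    by (intro meager_vimage_open_map open_map_eval0) auto
  then show ?thesis by (rule meager_subset) auto
qed

lemma meager_affine_vimage:
  assumes "meager M" "x \<noteq> 0"
  shows "meager {t :: nat \<Rightarrow> rseq. v + rat_scale x (t 0) \<in> M}"
proof -
  let ?f = "\<lambda>y. v + rat_scale x y" and ?g = "\<lambda>y. rat_scale (1 / x) (y + (- v))"
  have "continuous_on UNIV ?f" "continuous_on UNIV ?g"
    unfolding rat_scale_def plus_fun_def
    by (intro continuous_on_coordinatewise_then_product continuous_on_mult continuous_on_add
      continuous_on_const continuous_on_product_coordinates)+
  then have "meager (?f -` M)"
    by (rule meager_vimage_homeomorphism[OF _ _ _ _ assms(1)])
      (use assms(2) in \<open>auto simp: rat_scale_def fun_eq_iff of_rat_divide\<close>)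
  then have "meager ((\<lambda>t :: nat \<Rightarrow> rseq. t 0) -` (?f -` M))"
    by (rule meager_vimage_open_map[rotated 2]) (auto intro: open_map_eval0)
  then show ?thesis by (simp add: vimage_def)
qed

text \<open>Cohen genericity over \<open>M\<close> from stage \<open>a\<close> on. It is used in
  contrapositive form: if the entries at \<open>as @ bs\<close> already force membership in
  \<open>M\<close>, the last section is the whole space and not meager, so the section at
  \<open>as\<close> was not meager either.\<close>

definition propagates ::
  "('i \<Rightarrow> 'i \<Rightarrow> bool) \<Rightarrow> ('i \<Rightarrow> 'a::topological_space) \<Rightarrow> 'i \<Rightarrow> (nat \<Rightarrow> 'a) set \<Rightarrow> bool" where
  "propagates lt g a M \<longleftrightarrow> (\<forall>as bs. sorted_wrt lt bs \<longrightarrow> (\<forall>b\<in>set bs. \<not> lt b a) \<longrightarrow>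
     (\<forall>x\<in>set as. \<forall>b\<in>set bs. lt x b) \<longrightarrow>
     meager (sect M (map g as)) \<longrightarrow> meager (sect M (map g (as @ bs))))"

lemma propagatesD:
  assumes "propagates lt g a M" "sorted_wrt lt bs" "\<And>b. b \<in> set bs \<Longrightarrow> \<not> lt b a"
    "\<And>x b. x \<in> set as \<Longrightarrow> b \<in> set bs \<Longrightarrow> lt x b" "meager (sect M (map g as))"
  shows "meager (sect M (map g (as @ bs)))"
  using assms unfolding propagates_def by blast

text \<open>\<open>gen\<close> separates the generators of the group from the indices reserved for
  selectors. \<open>generic\<close> finds a reserved index from which a given countable family of
  Borel sets is respected; \<open>dense\<close> finds later generators in any open set.\<close>

locale generic_sequence =
  fixes lt :: "real \<Rightarrow> real \<Rightarrow> bool" and gen :: "real \<Rightarrow> bool" and g :: "real \<Rightarrow> rseq"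
  assumes trans: "transp lt" and wf: "wfP lt" and total: "totalp lt"
    and small: "\<And>a. {b. lt b a} \<prec> (UNIV :: real set)"
    and many: "(UNIV :: real set) \<lesssim> {a. gen a}"
    and nonmeager: "\<not> meager (UNIV :: (nat \<Rightarrow> rseq) set)"
    and generic: "\<And>C :: nat \<Rightarrow> (nat \<Rightarrow> rseq) set. range C \<subseteq> sets borel \<Longrightarrow>
      \<exists>a. \<not> gen a \<and> (\<forall>n. propagates lt g a (C n))"
    and dense: "\<And>V a. open V \<Longrightarrow> V \<noteq> {} \<Longrightarrow> \<exists>b. lt a b \<and> gen b \<and> g b \<in> V"
begin

definition L :: "rseq set" where "L = rat_fun.span (g ` {a. gen a})"

lemma irrefl: "\<not> lt a a"
  using wf by (meson wfp_imp_asymp asympD)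

lemma lt_linear: "a \<noteq> b \<Longrightarrow> lt a b \<or> lt b a"
  using total by (simp add: totalp_on_def)

lemma lt_trans: "lt a b \<Longrightarrow> lt b c \<Longrightarrow> lt a c"
  using trans by (rule transpD)

lemma finite_has_max:
  assumes "finite A" "A \<noteq> {}"
  shows "\<exists>m\<in>A. \<forall>a\<in>A. a = m \<or> lt a m"
  using assms
proof (induction rule: finite_ne_induct)
  case (insert x F)
  then obtain m where m: "m \<in> F" "\<forall>a\<in>F. a = m \<or> lt a m" by blast
  show ?case
  proof (cases "lt m x")
    case True
    have "a = x \<or> lt a x" if "a \<in> insert x F" for a
      using that m(2) True lt_trans[of a m x] by auto
    then show ?thesis by blast
  next
    case False
    then have "x = m \<or> lt x m" using lt_linear[of m x] by auto
    then show ?thesis using m by blast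
  qed
qed simp

lemma sorted_list_exists:
  "finite A \<Longrightarrow> \<exists>cs. set cs = A \<and> sorted_wrt lt cs"
proof (induction "card A" arbitrary: A)
  case 0
  then show ?case by (intro exI[of _ "[]"]) auto
next
  case (Suc n)
  have "A \<noteq> {}" using Suc.hyps(2) by auto
  obtain m where m: "m \<in> A" "\<forall>a\<in>A. a = m \<or> lt a m"
    using finite_has_max[OF Suc.prems \<open>A \<noteq> {}\<close>] by blast
  have "n = card (A - {m})" using Suc m by simp
  then obtain cs where "set cs = A - {m}" "sorted_wrt lt cs"
    using Suc.hyps(1)[of "A - {m}"] Suc.prems by auto
  then show ?case
    using m by (intro exI[of _ "cs @ [m]"]) (auto simp: sorted_wrt_append)
qed

lemma span_finite_support:
  assumes "finite F" "F \<subseteq> L"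
  obtains A where "finite A" "A \<subseteq> {a. gen a}" "F \<subseteq> rat_fun.span (g ` A)"
proof -
  have "\<exists>A. finite A \<and> A \<subseteq> {a. gen a} \<and> F \<subseteq> rat_fun.span (g ` A)"
    using assms
  proof (induction rule: finite_induct)
    case empty
    then show ?case by (intro exI[of _ "{}"]) auto
  next
    case (insert x F)
    then obtain A where A: "finite A" "A \<subseteq> {a. gen a}" "F \<subseteq> rat_fun.span (g ` A)" by blast
    have "x \<in> rat_fun.span (g ` {a. gen a})" using insert.prems by (simp add: L_def)
    then obtain S r where S: "finite S" "S \<subseteq> g ` {a. gen a}" "x = (\<Sum>a\<in>S. rat_scale (r a) a)"
      unfolding rat_fun.span_explicit by blast
    then obtain B where B: "B \<subseteq> {a. gen a}" "finite B" "S = g ` B"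
      using finite_subset_image[OF S(1,2)] by blast
    have "x \<in> rat_fun.span (g ` B)"
      unfolding S(3) B(3)
      by (intro rat_fun.span_sum rat_fun.span_scale rat_fun.span_base)
    then have "insert x F \<subseteq> rat_fun.span (g ` (A \<union> B))"
      using A(3) rat_fun.span_mono[of "g ` A" "g ` (A \<union> B)"] rat_fun.span_mono[of "g ` B" "g ` (A \<union> B)"]
      by blast
    then show ?case using A B by (intro exI[of _ "A \<union> B"]) auto
  qed
  then show ?thesis using that by blast
qed

text \<open>Let \<open>a\<close> respect the preimages of a Borel hull of \<open>M\<close> under all
  linear forms. With the earlier entries fixed, a form with non-zero last coefficient takes values
  in the hull only for a meager set of last entries, so a last index not below \<open>a\<close>
  keeps it out of \<open>M\<close>. Hence the trace consists of combinations of points with indices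
  below \<open>a\<close>, which are fewer than continuum many.\<close>

lemma meager_trace_small:
  assumes "meager M"
  shows "L \<inter> M \<prec> (UNIV :: real set)"
proof -
  obtain M' where M': "M \<subseteq> M'" "M' \<in> sets borel" "meager M'"
    using meager_borel_hull[OF assms] .
  define C where "C n = lin (from_nat n) -` M'" for n
  have "range C \<subseteq> sets borel"
    using measurable_sets_borel[OF borel_measurable_continuous_onI[OF continuous_lin] M'(2)]
    by (auto simp: C_def)
  then obtain a where a: "\<And>n. propagates lt g a (C n)"
    using generic[of C] by blast
  let ?Z = "lists {b. lt b a} \<times> (UNIV :: rat list set)"
  \<comment> \<open>The tail \<open>0\<close> is a filler: a form of the same length as the list
    does not read it.\<close>
  let ?ev = "\<lambda>(as, q). lin q (prefix (map g as) 0)"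
  have main: "lin q (prefix (map g cs) 0) \<in> M \<Longrightarrow> length q = length cs \<Longrightarrow> sorted_wrt lt cs \<Longrightarrow>
      lin q (prefix (map g cs) 0) \<in> ?ev ` ?Z" for cs q
  proof (induction cs arbitrary: q rule: rev_induct)
    case Nil
    then show ?case by (intro image_eqI[of _ _ "([], [])"]) auto
  next
    case (snoc c cs)
    obtain q' x where q: "q = q' @ [x]" "length q' = length cs"
      using snoc.prems(2) by (metis length_append_singleton length_Suc_conv_rev)
    have lin_q: "lin q (prefix (map g (cs @ [c])) t) = lin q' (prefix (map g cs) 0) + rat_scale x (g c)" for t
    proof -
      have "lin q' (prefix (map g (cs @ [c])) t) = lin q' (prefix (map g cs) 0)"
        by (rule lin_cong) (use q in \<open>simp add: prefix_def nth_append\<close>)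
      then show ?thesis using q by (simp add: lin_snoc prefix_def nth_append)
    qed
    show ?case
    \<comment> \<open>An index with zero coefficient carries no constraint and is dropped; the
      induction thus stops at the last non-zero coefficient.\<close>
    proof (cases "x = 0")
      case True
      then have eq: "lin q (prefix (map g (cs @ [c])) 0) = lin q' (prefix (map g cs) 0)"
        unfolding lin_q by (auto simp: rat_scale_def)
      have "sorted_wrt lt cs" using snoc.prems(3) by (simp add: sorted_wrt_append)
      then show ?thesis
        using snoc.IH[OF _ q(2)] snoc.prems(1) unfolding eq by blast
    next
      case False
      have sorted: "\<forall>x\<in>set cs. lt x c" using snoc.prems(3) by (simp add: sorted_wrt_append)
      have "lt c a"
      proof (rule ccontr)
        assume "\<not> lt c a"
        obtain n where n: "from_nat n = q" by (metis from_nat_to_nat)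
        have "sect (C n) (map g cs) = {t. lin q' (prefix (map g cs) 0) + rat_scale x (t 0) \<in> M'}"
        proof -
          have "lin q (prefix (map g cs) t) = lin q' (prefix (map g cs) 0) + rat_scale x (t 0)" for t
          proof -
            have "lin q' (prefix (map g cs) t) = lin q' (prefix (map g cs) 0)"
              by (rule lin_cong) (use q in \<open>simp add: prefix_def\<close>)
            then show ?thesis using q by (simp add: lin_snoc prefix_def)
          qed
          then show ?thesis by (simp add: sect_def C_def n)
        qed
        then have "meager (sect (C n) (map g cs))"
          using meager_affine_vimage[OF M'(3) False] by simp
        then have "meager (sect (C n) (map g (cs @ [c])))"
          by (intro propagatesD[OF a]) (use \<open>\<not> lt c a\<close> sorted in auto)
        moreover have "lin q (prefix (map g (cs @ [c])) t) \<in> M'" for t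
          using subsetD[OF M'(1) snoc.prems(1)] unfolding lin_q .
        then have "sect (C n) (map g (cs @ [c])) = UNIV"
          by (simp add: sect_def C_def n del: map_append)
        ultimately show False using nonmeager by simp
      qed
      then have "set (cs @ [c]) \<subseteq> {b. lt b a}" using sorted lt_trans by auto
      then show ?thesis by (intro image_eqI[of _ _ "(cs @ [c], q)"]) (auto simp: lists_eq_set)
    qed
  qed
  have "L \<inter> M \<subseteq> ?ev ` ?Z"
  proof
    fix v assume v: "v \<in> L \<inter> M"
    obtain A where A: "finite A" "A \<subseteq> {a. gen a}" "{v} \<subseteq> rat_fun.span (g ` A)"
      using span_finite_support[of "{v}"] v by auto
    obtain cs where cs: "set cs = A" "sorted_wrt lt cs" using sorted_list_exists[OF A(1)] by blast
    obtain q where "length q = length cs" "v = lin q (prefix (map g cs) 0)"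
      using span_image_imp_lin[of v g A cs 0] A cs by blast
    then show "v \<in> ?ev ` ?Z" using main[of q cs] v cs(2) by blast
  qed
  then have "L \<inter> M \<lesssim> ?Z" by (rule subset_image_lepoll)
  also have "?Z \<prec> (UNIV :: real set)"
    by (rule lesspoll_Times[OF lists_lesspoll_real[OF small]])
      (simp_all add: countable_lesspoll_real infinite_UNIV_real)
  finally show ?thesis .
qed

text \<open>The sequences whose first two entries agree form a closed set with meager sections over
  a single point, so \<open>g\<close> is injective on the generators not below the stage
  \<open>a\<close> of this set. Discarding the indices below \<open>a\<close> leaves continuum many
  generators.\<close>

lemma continuum_lepoll_L: "(UNIV :: real set) \<lesssim> L"
proof -
  define C where "C n = {t :: nat \<Rightarrow> rseq. t 0 = t 1}" for n :: nat
  have "closed (C n)" for n unfolding C_def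
    by (intro closed_Collect_eq continuous_on_product_coordinates)
  then have "range C \<subseteq> sets borel" by auto
  then obtain a where a: "\<And>n. propagates lt g a (C n)"
    using generic[of C] by blast
  have neq: "g b \<noteq> g c" if "lt b c" "\<not> lt c a" for b c
  proof
    assume eq: "g b = g c"
    have "sect (C 0) (map g [b]) = {t. g b = t 0}" by (simp add: sect_def C_def prefix_def)
    moreover have "meager ((\<lambda>t :: nat \<Rightarrow> rseq. t 0) -` {g b})"
      by (intro meager_vimage_open_map open_map_eval0 meager_singleton) auto
    ultimately have "meager (sect (C 0) (map g [b]))" by (auto simp: vimage_def eq_commute)
    then have "meager (sect (C 0) (map g ([b] @ [c])))" by (intro propagatesD[OF a]) (use that in auto)
    moreover have "sect (C 0) (map g ([b] @ [c])) = UNIV" using eq by (simp add: sect_def C_def prefix_def)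
    ultimately show False using nonmeager by simp
  qed
  let ?B = "{b. gen b} - {b. lt b a}"
  have "inj_on g ?B"
    by (rule inj_onI) (metis DiffD2 lt_linear mem_Collect_eq neq)
  then have "?B \<lesssim> L"
    unfolding lepoll_def L_def by (intro exI[of _ g]) (auto intro: rat_fun.span_base)
  moreover have "(UNIV :: real set) \<lesssim> ?B"
  proof (rule ccontr)
    assume "\<not> (UNIV :: real set) \<lesssim> ?B"
    then have "?B \<prec> (UNIV :: real set)"
      using lepoll_total[of ?B "UNIV :: real set"] by (metis lepoll_iff_leqpoll eqpoll_imp_lepoll eqpoll_sym)
    then have "?B \<union> {b. lt b a} \<prec> (UNIV :: real set)"
      by (intro lesspoll_Un small infinite_UNIV_real)
    moreover have "{a. gen a} \<lesssim> ?B \<union> {b. lt b a}" by (intro subset_imp_lepoll) auto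
    ultimately have "(UNIV :: real set) \<prec> (UNIV :: real set)"
      using lesspoll_trans1 lepoll_trans[OF many] by blast
    then show False by simp
  qed
  ultimately show ?thesis by (rule lepoll_trans[rotated])
qed

lemma Luzin_L: "Luzin (UNIV :: real set) L"
  unfolding Luzin_def using continuum_lepoll_L meager_trace_small by blast

end

section \<open>Selection of omega-covers\<close>

lemma borel_subsets_trace:
  assumes "V \<in> borel_subsets X"
  shows "\<exists>B\<in>sets borel. V = B \<inter> X"
  using assms unfolding borel_subsets_def
proof induction
  case (Basic V)
  then obtain T where "open T" "V = X \<inter> T" by (auto simp: openin_open)
  then show ?case by (intro bexI[of _ T]) auto
next
  case Empty
  show ?case by (intro bexI[of _ "{}"]) auto
next
  case (Compl V)
  then obtain B where "B \<in> sets borel" "V = B \<inter> X" by blast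
  then show ?case by (intro bexI[of _ "- B"]) (auto simp: borel_comp)
next
  case (Union V)
  then obtain B where B: "\<And>n. B n \<in> sets borel" "\<And>n. V n = B n \<inter> X" by metis
  then show ?case by (intro bexI[of _ "\<Union>n. B n"]) auto
qed

lemma open_contains_box:
  fixes G :: "(nat \<Rightarrow> 'a::topological_space) set"
  assumes "open G" "t \<in> G"
  shows "\<exists>V k. (\<forall>i. open (V i)) \<and> (\<forall>i. t i \<in> V i) \<and> (\<forall>i\<ge>k. V i = UNIV) \<and>
    {s. \<forall>i. s i \<in> V i} \<subseteq> G"
proof -
  have G: "openin (product_topology (\<lambda>_. euclidean) UNIV) G"
    using assms(1) by (simp add: euclidean_product_topology)
  obtain V where V: "t \<in> Pi\<^sub>E UNIV V" "\<And>i. openin euclidean (V i)"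
      "finite {i. V i \<noteq> topspace euclidean}" "Pi\<^sub>E UNIV V \<subseteq> G"
    using product_topology_open_contains_basis[OF G assms(2)] by blast
  obtain k where k: "\<And>i. i \<in> {i. V i \<noteq> UNIV} \<Longrightarrow> i < k"
    using finite_nat_set_iff_bounded V(3) by auto
  show ?thesis
  proof (intro exI conjI allI impI)
    show "open (V i)" for i using V(2) by simp
    show "t i \<in> V i" for i using V(1) by auto
    show "V i = UNIV" if "i \<ge> k" for i using k[of i] that by force
    show "{s. \<forall>i. s i \<in> V i} \<subseteq> G" using V(4) by (auto simp: PiE_UNIV_domain)
  qed
qed

text \<open>Countably many translates of the part of \<open>E\<close> above the interval cover \<open>E\<close>.\<close>

lemma meager_coordinate_invariant:
  fixes E :: "(nat \<Rightarrow> rseq) set"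
  assumes inv: "\<And>s c. s \<in> E \<Longrightarrow> s(i := (s i)(n := s i n + c)) \<in> E"
    and meager: "meager {s \<in> E. a < s i n \<and> s i n < b}" and "a < b"
  shows "meager E"
proof -
  \<comment> \<open>\<open>\<tau> c\<close> translates the single real coordinate
    \<open>s i n\<close>. It is a homeomorphism of the whole space, and since the interval is open,
    a rational shift brings any point of \<open>E\<close> above it.\<close>
  define \<tau> where "\<tau> c s = (\<lambda>k l. s k l + (if k = i \<and> l = n then c else 0))" for c :: real and s :: "nat \<Rightarrow> rseq"
  have \<tau>_eq: "\<tau> c s = s(i := (s i)(n := s i n + c))" for c s
    by (auto simp: \<tau>_def fun_eq_iff)
  have \<tau>_cont: "continuous_on UNIV (\<tau> c)" for c
    unfolding \<tau>_def
    by (rule continuous_on_coordinatewise_then_product, rule continuous_on_coordinatewise_then_product)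
      (intro continuous_on_add continuous_coordinate2 continuous_on_const)
  have "meager (\<tau> c -` {s \<in> E. a < s i n \<and> s i n < b})" for c
    by (rule meager_vimage_homeomorphism[OF \<tau>_cont \<tau>_cont[of "- c"] _ _ meager])
      (auto simp: \<tau>_def fun_eq_iff)
  then have "meager (\<Union>q :: rat. \<tau> (of_rat q) -` {s \<in> E. a < s i n \<and> s i n < b})"
    by (intro meager_UN) auto
  moreover have "E \<subseteq> (\<Union>q :: rat. \<tau> (of_rat q) -` {s \<in> E. a < s i n \<and> s i n < b})"
  proof
    fix s assume s: "s \<in> E"
    obtain q where q: "a - s i n < of_rat q" "of_rat q < b - s i n"
      using of_rat_dense[of "a - s i n" "b - s i n"] \<open>a < b\<close> by auto
    then have "\<tau> (of_rat q) s \<in> {s \<in> E. a < s i n \<and> s i n < b}"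
      using inv[OF s] by (simp add: \<tau>_eq)
    then show "s \<in> (\<Union>q :: rat. \<tau> (of_rat q) -` {s \<in> E. a < s i n \<and> s i n < b})" by blast
  qed
  ultimately show ?thesis by (rule meager_subset)
qed

lemma lin_prefix_indep:
  "length q \<le> length ps \<Longrightarrow> lin q (prefix ps t) = lin q (prefix ps t')"
  by (rule lin_cong) (simp add: prefix_def)

section \<open>Generic points as selectors\<close>

context generic_sequence
begin

lemma generic_tuple_in_box:
  assumes "finite S" "\<And>i. open (V i)" "\<And>i. V i \<noteq> {}"
  shows "\<exists>bs. length bs = k \<and> sorted_wrt lt bs \<and> (\<forall>b\<in>set bs. gen b \<and> (\<forall>s\<in>S. lt s b)) \<and>
    (\<forall>i<k. g (bs ! i) \<in> V i)"
proof (induction k)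
  case (Suc k)
  then obtain bs where bs: "length bs = k" "sorted_wrt lt bs"
    "\<forall>b\<in>set bs. gen b \<and> (\<forall>s\<in>S. lt s b)" "\<forall>i<k. g (bs ! i) \<in> V i" by blast
  \<comment> \<open>Inserting \<open>undefined\<close> only ensures that there is a maximum when the
    set of earlier indices is empty.\<close>
  obtain m where m: "\<forall>s\<in>S \<union> set bs. s = m \<or> lt s m"
    using finite_has_max[of "insert undefined (S \<union> set bs)"] assms(1) by auto
  obtain b where b: "lt m b" "gen b" "g b \<in> V k" using dense[OF assms(2,3)] by blast
  have "lt s b" if "s \<in> S \<union> set bs" for s
    using bspec[OF m, of s] b(1) that lt_trans[of s m b] by auto
  then show ?case
    using bs b by (intro exI[of _ "bs @ [b]"]) (auto simp: sorted_wrt_append nth_append less_Suc_eq)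
qed simp

text \<open>Choosing the value \<open>m\<close> at place \<open>n\<close> amounts to confining one
  real coordinate to an interval, so a generic point makes its choices independently at different
  places.\<close>

definition sel :: "rseq \<Rightarrow> nat \<Rightarrow> nat" where
  "sel x n = nat \<lfloor>x n\<rfloor>"

text \<open>The tuples for which the selector given by the entry \<open>j\<close> fails to catch the linear
  combinations in \<open>Q\<close>.\<close>

definition missed :: "(nat \<Rightarrow> nat \<Rightarrow> rseq set) \<Rightarrow> nat \<Rightarrow> rat list list \<Rightarrow> (nat \<Rightarrow> rseq) set" where
  "missed B j Q = {t. \<forall>n. \<exists>q\<in>set Q. lin q t \<notin> B n (sel (t j) n)}"

lemma lin_vimage_borel: "B \<in> sets borel \<Longrightarrow> lin q -` B \<in> sets borel"
  by (rule measurable_sets_borel[OF borel_measurable_continuous_onI[OF continuous_lin]])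

lemma missed_borel:
  assumes "\<And>n m. B n m \<in> sets borel"
  shows "missed B j Q \<in> sets borel"
proof -
  have sel: "{t. sel (t j) n = m} \<in> sets borel" for n m
  proof -
    have "(\<lambda>t :: nat \<Rightarrow> rseq. t j n) \<in> borel_measurable borel"
      by (rule borel_measurable_continuous_onI[OF continuous_coordinate2])
    then have "(\<lambda>t :: nat \<Rightarrow> rseq. nat \<lfloor>t j n\<rfloor>) \<in> measurable borel (count_space UNIV)"
      by simp
    then have "(\<lambda>t :: nat \<Rightarrow> rseq. nat \<lfloor>t j n\<rfloor>) -` {m} \<inter> space borel \<in> sets borel"
      by (rule measurable_sets) simp
    then show ?thesis by (simp add: sel_def vimage_def)
  qed
  have "missed B j Q = (\<Inter>n. \<Union>q\<in>set Q. \<Union>m. {t. sel (t j) n = m} \<inter> lin q -` (- B n m))"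
    by (auto simp: missed_def)
  also have "\<dots> \<in> sets borel"
    using assms by (intro sets.countable_INT'' sets.countable_UN'' sets.finite_UN sets.Int sel lin_vimage_borel)
      (auto simp: borel_comp)
  finally show ?thesis .
qed

text \<open>A non-meager section would be comeager in a box that leaves the choice at some place
  \<open>n\<close> open. As the forms in \<open>Q\<close> ignore the selector, the points of the box
  whose values all lie in one member of cover \<open>n\<close> would then be meager. But generators
  placed generically in this box yield a finite subset of \<open>L\<close>, which some member of
  cover \<open>n\<close> contains.\<close>

lemma missed_section_meager:
  assumes B: "\<And>n m. B n m \<in> sets borel"
    and cover: "\<And>n F. finite F \<Longrightarrow> F \<subseteq> L \<Longrightarrow> \<exists>m. F \<subseteq> B n m"
    and as: "set as \<subseteq> {a. gen a}" "length as = j"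
    and Q: "\<And>q. q \<in> set Q \<Longrightarrow> j < length q \<Longrightarrow> q ! j = 0"
  shows "meager (sect (missed B j Q) (map g as))"
proof (rule ccontr)
  let ?A = "sect (missed B j Q) (map g as)"
  let ?p = "\<lambda>s. prefix (map g as) s"
  assume nonmeager_A: "\<not> meager ?A"
  have "?A \<in> sets borel" by (intro sect_borel missed_borel B)
  from borel_nonmeager_comeager_in_open[OF this nonmeager_A]
  obtain G where G: "open G" "G \<noteq> {}" "meager (G - ?A)" .
  obtain t0 where t0: "t0 \<in> G" using G(2) by blast
  obtain W k where W: "\<forall>i. open (W i)" "\<forall>i. t0 i \<in> W i" "\<forall>i\<ge>k. W i = UNIV"
    "{s. \<forall>i. s i \<in> W i} \<subseteq> G"
    using open_contains_box[OF G(1) t0] by blast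
  \<comment> \<open>Only coordinates below \<open>n\<close> of the selector entry get restricted, so
    its choice at place \<open>n\<close> remains free.\<close>
  obtain H n where H: "\<forall>i. open (H i)" "\<forall>i. t0 0 i \<in> H i" "\<forall>i\<ge>n. H i = UNIV"
    "{x. \<forall>i. x i \<in> H i} \<subseteq> W 0"
    using open_contains_box[OF W(1)[rule_format, of 0] W(2)[rule_format, of 0]] by blast
  define V where "V i = (if i = 0 then {x. \<forall>i. x i \<in> H i} else W i)" for i
  have V_mem: "t0 i \<in> V i" for i using W H by (simp add: V_def)
  have "open {x. \<forall>i. x i \<in> H i}"
  proof -
    have "{x. \<forall>i. x i \<in> H i} = Pi\<^sub>E UNIV H" by (auto simp: PiE_UNIV_domain)
    moreover have "finite {i. H i \<noteq> UNIV}"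
      by (rule finite_subset[of _ "{..<n}"]) (use H(3) in \<open>auto simp: not_le[symmetric]\<close>)
    ultimately show ?thesis using open_PiE[of H] H(1) by simp
  qed
  then have V_open: "open (V i)" for i using W(1) by (simp add: V_def)
  define box where "box = {s. \<forall>i. s i \<in> V i}"
  have box_iff: "s \<in> box \<longleftrightarrow> (\<forall>i. s 0 i \<in> H i) \<and> (\<forall>i>0. s i \<in> W i)" for s
    unfolding box_def V_def by (auto split: if_splits)
  have box_G: "box \<subseteq> G" 
  proof
    fix s assume "s \<in> box"
    then have "s i \<in> W i" for i using H(4) box_iff[of s] by (cases "i = 0") auto
    then show "s \<in> G" using W(4) by blast
  qed
  \<comment> \<open>Shifting coordinate \<open>n\<close> of the selector keeps a point in
    \<open>E m\<close>, because its coefficient in every form is zero. Where the selector chooses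
    \<open>m\<close> at place \<open>n\<close>, a point of \<open>E m\<close> is not missed.\<close>
  define E where "E m = {s \<in> box. \<forall>q\<in>set Q. lin q (?p s) \<in> B n m}" for m
  have E_meager: "meager (E m)" for m
  proof (rule meager_coordinate_invariant[where i = 0 and n = n and a = "real m" and b = "real m + 1"])
    fix s c assume s: "s \<in> E m"
    let ?s = "s(0 := (s 0)(n := s 0 n + c))"
    have "?s \<in> box" using s H(3) by (auto simp: E_def box_iff)
    moreover have "lin q (?p ?s) = lin q (?p s)" if q: "q \<in> set Q" for q
    proof (rule lin_cong)
      fix i assume i: "i < length q"
      show "q ! i = 0 \<or> ?p ?s i = ?p s i"
        using Q[OF q] i as(2) by (cases "i = j") (auto simp: prefix_def)
    qed
    ultimately show "?s \<in> E m" using s by (simp add: E_def)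
  next
    have "{s \<in> E m. real m < s 0 n \<and> s 0 n < real m + 1} \<subseteq> G - ?A"
    proof
      fix s assume s: "s \<in> {s \<in> E m. real m < s 0 n \<and> s 0 n < real m + 1}"
      then have "\<lfloor>s 0 n\<rfloor> = int m" by (intro floor_unique) auto
      then have "sel (?p s j) n = m" using as(2) by (simp add: prefix_def sel_def)
      then have "s \<notin> ?A" using s by (auto simp: sect_def missed_def E_def)
      then show "s \<in> G - ?A" using s box_G by (auto simp: E_def)
    qed
    then show "meager {s \<in> E m. real m < s 0 n \<and> s 0 n < real m + 1}"
      by (rule meager_subset[OF G(3)])
  qed simp
  \<comment> \<open>\<open>N\<close> is phrased for whole tuples, with the box moved to start at
    position \<open>j\<close>. It is therefore a Borel set to which genericity applies, and its
    section over \<open>as\<close> is the union of the \<open>E m\<close>.\<close>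
  define N where "N = {t. \<forall>i. t (j + i) \<in> V i} \<inter> (\<Union>m. \<Inter>q\<in>set Q. lin q -` B n m)"
  have "N \<in> sets borel"
  proof -
    have "(\<lambda>t :: nat \<Rightarrow> rseq. t (j + i)) -` V i \<in> sets borel" for i
      by (intro borel_open open_vimage V_open) simp
    then have "(\<Inter>i. (\<lambda>t :: nat \<Rightarrow> rseq. t (j + i)) -` V i) \<in> sets borel" by blast
    moreover have "{t. \<forall>i. t (j + i) \<in> V i} = (\<Inter>i. (\<lambda>t :: nat \<Rightarrow> rseq. t (j + i)) -` V i)" by auto
    moreover have "(\<Inter>q\<in>set Q. lin q -` B n m) \<in> sets borel" for m
      by (cases "set Q = {}") (auto intro!: sets.finite_INT lin_vimage_borel B)
    ultimately show ?thesis unfolding N_def by (intro sets.Int sets.countable_UN'') auto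
  qed
  then obtain a where a: "propagates lt g a N"
    using generic[of "\<lambda>_. N"] by blast
  have "sect N (map g as) = (\<Union>m. E m)"
    using as(2) by (auto simp: sect_def N_def E_def box_def prefix_def)
  then have N_meager: "meager (sect N (map g as))" using meager_UN_nat[OF E_meager] by simp
  \<comment> \<open>The tuple must reach past all restricted positions and all forms, so that it
    decides membership in \<open>N\<close>. \<open>Suc k\<close> is used because position
    \<open>0\<close> is restricted by \<open>H\<close> even when \<open>k = 0\<close>.\<close>
  define k' where "k' = Max (insert (Suc k) (length ` set Q))"
  have "Suc k \<le> k'" unfolding k'_def by (rule Max_ge) simp_all
  moreover have "length q \<le> k'" if "q \<in> set Q" for q
    unfolding k'_def using that by (intro Max_ge) simp_all
  ultimately have k': "k < k'" "\<And>q. q \<in> set Q \<Longrightarrow> length q \<le> k'" by simp_all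
  obtain bs where bs: "length bs = k'" "sorted_wrt lt bs"
    "\<forall>b\<in>set bs. gen b \<and> (\<forall>s\<in>insert a (set as). lt s b)" "\<forall>i<k'. g (bs ! i) \<in> V i"
    using generic_tuple_in_box[of "insert a (set as)" V k'] V_open V_mem by blast
  let ?cs = "as @ bs"
  have "meager (sect N (map g ?cs))"
    by (rule propagatesD[OF a bs(2) _ _ N_meager]) (use bs(3) irrefl lt_trans in blast)+
  moreover have "sect N (map g ?cs) = UNIV"
  proof -
    let ?F = "(\<lambda>q. lin q (prefix (map g ?cs) 0)) ` set Q"
    have len: "length q \<le> length ?cs" if "q \<in> set Q" for q
      using k'(2)[OF that] bs(1) by simp
    have "lin q (prefix (map g ?cs) 0) \<in> L" if "q \<in> set Q" for q
      unfolding L_def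
    proof (rule lin_in_span)
      fix i assume "i < length q"
      then have i: "i < length ?cs" using len[OF that] by simp
      then have "?cs ! i \<in> set ?cs" by (rule nth_mem)
      then have "gen (?cs ! i)" using as(1) bs(3) by auto
      then show "q ! i = 0 \<or> prefix (map g ?cs) 0 i \<in> g ` {a. gen a}"
        using i unfolding prefix_def by (simp del: map_append)
    qed
    then obtain m where m: "?F \<subseteq> B n m" using cover[of ?F n] by auto
    have "lin q (prefix (map g ?cs) t) \<in> B n m" if "q \<in> set Q" for q t
      using m that lin_prefix_indep[of q "map g ?cs" t 0] len[OF that] by auto
    moreover have "prefix (map g ?cs) t (j + i) \<in> V i" for t i
    proof (cases "i < k'")
      case True
      then show ?thesis using bs(1,4) as(2) by (simp add: prefix_def nth_append)
    next
      case False
      then have "V i = UNIV" using W(3) k'(1) by (simp add: V_def)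
      then show ?thesis by simp
    qed
    ultimately show ?thesis by (auto simp: sect_def N_def simp del: map_append)
  qed
  ultimately show False using nonmeager by simp
qed

text \<open>The selector is \<open>g a\<close> for a reserved index \<open>a\<close> generic over
  all missed sets. If it missed a finite set supported before and after \<open>a\<close>, the
  section of a missed set over the whole support would be everything; yet it is meager over the
  indices before \<open>a\<close>, and genericity carries this on to the end.\<close>

lemma S1_L: "S1 (borel_omega_covers L) (borel_omega_covers L)"
  unfolding S1_def
proof (intro allI impI)
  fix \<U> assume \<U>: "\<forall>n :: nat. \<U> n \<in> borel_omega_covers L"
  have \<U>D: "countable (\<U> n)" "\<U> n \<subseteq> borel_subsets L" "L \<notin> \<U> n"
    "\<And>F. finite F \<Longrightarrow> F \<subseteq> L \<Longrightarrow> \<exists>U\<in>\<U> n. F \<subseteq> U" for n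
    using \<U>[rule_format, of n] unfolding borel_omega_covers_def by blast+
  have ne: "\<U> n \<noteq> {}" for n using \<U>D(4)[of "{}" n] by blast
  have "\<exists>B\<in>sets borel. from_nat_into (\<U> n) m = B \<inter> L" for n m
    using borel_subsets_trace from_nat_into[OF ne] \<U>D(2) by blast
  then obtain B where B: "\<And>n m. B n m \<in> sets borel" "\<And>n m. from_nat_into (\<U> n) m = B n m \<inter> L"
    by metis
  have BU: "B n m \<inter> L \<in> \<U> n" for n m using from_nat_into[OF ne, of n m] B(2) by simp
  have cover: "\<exists>m. F \<subseteq> B n m" if F: "finite F" "F \<subseteq> L" for n F
  proof -
    obtain U where U: "U \<in> \<U> n" "F \<subseteq> U" using \<U>D(4)[OF F] by blast
    obtain m where "from_nat_into (\<U> n) m = U" using from_nat_into_surj[OF \<U>D(1) U(1)] by blast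
    then show ?thesis using B(2) U(2) by blast
  qed
  \<comment> \<open>The position of the selector in the later tuples is not known in advance, so a
    missed set is listed for every \<open>j\<close> and every finite list of forms.\<close>
  define C where "C i = (case from_nat i of (j, Q) \<Rightarrow> missed B j Q)" for i
  have "range C \<subseteq> sets borel" using missed_borel[OF B(1)] by (auto simp: C_def split: prod.split)
  then obtain a where a: "\<not> gen a" "\<And>i. propagates lt g a (C i)" using generic[of C] by blast
  have propagates: "propagates lt g a (missed B j Q)" for j Q
    using a(2)[of "to_nat (j, Q)"] by (simp add: C_def)
  define U where "U n = B n (sel (g a) n) \<inter> L" for n
  have U: "U n \<in> \<U> n" for n using BU by (simp add: U_def)
  have catch: "\<exists>n. F \<subseteq> U n" if F: "finite F" "F \<subseteq> L" for F
  proof (rule ccontr)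
    assume contr: "\<nexists>n. F \<subseteq> U n"
    obtain A where A: "finite A" "A \<subseteq> {a. gen a}" "F \<subseteq> rat_fun.span (g ` A)"
      using span_finite_support[OF F] .
    \<comment> \<open>The support is split at the selector. As \<open>a\<close> is not a generator,
      it can be inserted between the two halves with coefficient zero.\<close>
    obtain as where as: "set as = {b \<in> A. lt b a}" "sorted_wrt lt as"
      using sorted_list_exists[of "{b \<in> A. lt b a}"] A(1) by auto
    obtain bs where bs: "set bs = {b \<in> A. lt a b}" "sorted_wrt lt bs"
      using sorted_list_exists[of "{b \<in> A. lt a b}"] A(1) by auto
    let ?cs = "as @ a # bs"
    have "a \<notin> A" using a(1) A(2) by blast
    then have "A \<subseteq> set ?cs" using as(1) bs(1) lt_linear by auto
    then have "\<exists>q. length q = length ?cs \<and> (\<forall>i<length ?cs. ?cs ! i \<notin> A \<longrightarrow> q ! i = 0) \<and>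
        v = lin q (prefix (map g ?cs) 0)" if "v \<in> F" for v
      using span_image_imp_lin[of v g A ?cs 0] A(3) that by blast
    then obtain qf where qf: "\<And>v. v \<in> F \<Longrightarrow> length (qf v) = length ?cs"
      "\<And>v i. v \<in> F \<Longrightarrow> i < length ?cs \<Longrightarrow> ?cs ! i \<notin> A \<Longrightarrow> qf v ! i = 0"
      "\<And>v. v \<in> F \<Longrightarrow> v = lin (qf v) (prefix (map g ?cs) 0)"
      by metis
    obtain vs where vs: "set vs = F" using finite_list[OF F(1)] by blast
    define Q where "Q = map qf vs"
    have "meager (sect (missed B (length as) Q) (map g as))"
    proof (rule missed_section_meager[OF B(1) cover])
      show "set as \<subseteq> {a. gen a}" using as(1) A(2) by blast
      fix q assume "q \<in> set Q" "length as < length q"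
      then show "q ! length as = 0" using qf(2)[of _ "length as"] \<open>a \<notin> A\<close> vs by (auto simp: Q_def)
    qed simp_all
    then have "meager (sect (missed B (length as) Q) (map g ?cs))"
    proof (rule propagatesD[OF propagates, rotated -1])
      show "sorted_wrt lt (a # bs)" using bs by simp
      show "\<not> lt b a" if "b \<in> set (a # bs)" for b
        using that bs(1) irrefl lt_trans by (metis mem_Collect_eq set_ConsD)
      show "lt x b" if "x \<in> set as" "b \<in> set (a # bs)" for x b
        using that as(1) bs(1) lt_trans by (metis mem_Collect_eq set_ConsD)
    qed
    moreover have "sect (missed B (length as) Q) (map g ?cs) = UNIV"
    proof -
      have "\<exists>q\<in>set Q. lin q (prefix (map g ?cs) t) \<notin> B n (sel (prefix (map g ?cs) t (length as)) n)" for t n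
      proof -
        obtain v where v: "v \<in> F" "v \<notin> U n" using contr by blast
        then have "v \<notin> B n (sel (g a) n)" using F(2) by (auto simp: U_def)
        moreover have "prefix (map g ?cs) t (length as) = g a" by (simp add: prefix_def nth_append)
        moreover have "lin (qf v) (prefix (map g ?cs) t) = v"
          using lin_prefix_indep[of "qf v" "map g ?cs" t 0] qf(1,3)[OF v(1)] by simp
        ultimately show ?thesis
          by (intro bexI[of _ "qf v"]) (use v(1) vs in \<open>simp_all add: Q_def del: map_append\<close>)
      qed
      then show ?thesis by (auto simp: sect_def missed_def simp del: map_append)
    qed
    ultimately show False using nonmeager by simp
  qed
  have "range U \<in> borel_omega_covers L"
    unfolding borel_omega_covers_def
  proof (intro CollectI conjI allI impI)
    show "range U \<subseteq> borel_subsets L" using U \<U>D(2) by blast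
    show "\<Union> (range U) = L"
    proof
      show "L \<subseteq> \<Union> (range U)"
      proof
        fix x assume "x \<in> L"
        then show "x \<in> \<Union> (range U)" using catch[of "{x}"] by auto
      qed
    qed (auto simp: U_def)
    show "L \<notin> range U" using U \<U>D(3) by (metis rangeE)
    show "\<exists>V\<in>range U. F \<subseteq> V" if "finite F \<and> F \<subseteq> L" for F
      using catch[of F] that by auto
  qed simp
  with U show "\<exists>U. (\<forall>n. U n \<in> \<U> n) \<and> range U \<in> borel_omega_covers L" by blast
qed

end

section \<open>Construction of the groups\<close>

text \<open>The entries that would spoil a meager section. Taking the empty set when the section is
  already non-meager makes this set meager in all cases, by Kuratowski-Ulam.\<close>

definition bad_points ::
  "('i \<Rightarrow> 'a::topological_space) \<Rightarrow> (nat \<Rightarrow> 'a) set \<Rightarrow> 'i list \<Rightarrow> 'a set" where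
  "bad_points g M ps =
     (if meager (sect M (map g ps)) then {x. \<not> meager (sect M (map g ps @ [x]))} else {})"

lemma meager_bad_points:
  fixes g :: "'i \<Rightarrow> 'a::second_countable_topology"
  shows "meager (bad_points g M ps)"
  using Kuratowski_Ulam[of "sect M (map g ps)"] by (simp add: bad_points_def sect_append)

lemma bad_points_cong:
  "(\<And>p. p \<in> set ps \<Longrightarrow> g p = g' p) \<Longrightarrow> bad_points g M ps = bad_points g' M ps"
  by (simp add: bad_points_def cong: map_cong)

text \<open>The entries of \<open>bs\<close> are appended one at a time; each has an index at or
  after \<open>a\<close> and above all indices already used.\<close>

lemma propagates_if_avoids_bad_points:
  assumes "totalp lt"
    and avoid: "\<And>b ps. b = a \<or> lt a b \<Longrightarrow> (\<And>p. p \<in> set ps \<Longrightarrow> lt p b) \<Longrightarrow> g b \<notin> bad_points g M ps"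
  shows "propagates lt g a M"
proof -
  have "meager (sect M (map g (as @ bs)))"
    if "sorted_wrt lt bs" "\<forall>b\<in>set bs. \<not> lt b a" "\<forall>x\<in>set as. \<forall>b\<in>set bs. lt x b"
      "meager (sect M (map g as))" for as bs
    using that
  proof (induction bs rule: rev_induct)
    case (snoc b bs)
    have "meager (sect M (map g (as @ bs)))"
      using snoc by (simp add: sorted_wrt_append)
    moreover have "g b \<notin> bad_points g M (as @ bs)"
    proof (rule avoid)
      show "b = a \<or> lt a b" using snoc.prems(2) assms(1) by (auto simp: totalp_on_def)
      show "lt p b" if "p \<in> set (as @ bs)" for p
        using that snoc.prems(1,3) by (auto simp: sorted_wrt_append)
    qed
    ultimately show ?case by (simp add: bad_points_def)
  qed simp
  then show ?thesis unfolding propagates_def by blast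
qed

lemma cov_meager_avoid:
  fixes W :: "'a::polish_space set"
  assumes "cov_meager_eq_continuum" "I \<prec> (UNIV :: real set)" "\<And>i. i \<in> I \<Longrightarrow> meager (M i)"
    and "open W" "W \<noteq> {}"
  shows "\<exists>x\<in>W. \<forall>i\<in>I. x \<notin> M i"
  using cov_meager_polish[OF assms(1) image_lesspoll[OF assms(2), of M] _ assms(4,5)] assms(3)
  by blast

lemma uminus_diff_homeomorphism: "continuous_on UNIV (\<lambda>x :: rseq. z - x)"
  unfolding fun_diff_def
  by (rule continuous_on_coordinatewise_then_product)
    (intro continuous_on_diff continuous_on_const continuous_on_product_coordinates)

text \<open>At stage \<open>a\<close> the map taking \<open>x\<close> to \<open>z a - x\<close> is a
  homeomorphism, so the conditions on both sequences become fewer than continuum many meager sets to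
  be avoided by the single choice \<open>x = g a\<close>.\<close>

lemma simultaneous_generic_sequences:
  fixes lt :: "real \<Rightarrow> real \<Rightarrow> bool" and C :: "real \<Rightarrow> nat \<Rightarrow> (nat \<Rightarrow> rseq) set"
    and z :: "real \<Rightarrow> rseq" and W :: "real \<Rightarrow> rseq set"
  assumes cov: "cov_meager_eq_continuum"
    and lt: "wfP lt" "totalp lt" "\<And>a. {b. lt b a} \<prec> (UNIV :: real set)"
    and W: "\<And>a. open (W a)" "\<And>a. W a \<noteq> {}"
  obtains g where "\<And>a. g a \<in> W a" "\<And>a n. propagates lt g a (C a n)"
    "\<And>a n. propagates lt (\<lambda>b. z b - g b) a (C a n)"
proof -
  \<comment> \<open>The sets listed at stage \<open>a\<close> itself are included, since propagation
    from \<open>a\<close> on also concerns the entry at \<open>a\<close>.\<close>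
  define P where "P f a x \<longleftrightarrow> x \<in> W a \<and>
    (\<forall>d n ps. d \<in> insert a {b. lt b a} \<longrightarrow> ps \<in> lists {b. lt b a} \<longrightarrow>
      x \<notin> bad_points f (C d n) ps \<and> z a - x \<notin> bad_points (\<lambda>b. z b - f b) (C d n) ps)"
    for f :: "real \<Rightarrow> rseq" and a x
  have "\<exists>g. \<forall>a. P g a (g a)"
  proof (rule dependent_wf_choice)
    show "wf {(b, a). lt b a}" using lt(1) by (simp add: wfp_def)
  next
    fix f f' :: "real \<Rightarrow> rseq" and a x
    assume eq: "\<And>b. (b, a) \<in> {(b, a). lt b a} \<Longrightarrow> f b = f' b"
    have "bad_points f M ps = bad_points f' M ps"
      "bad_points (\<lambda>b. z b - f b) M ps = bad_points (\<lambda>b. z b - f' b) M ps"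
      if "ps \<in> lists {b. lt b a}" for M ps
      using eq that by (auto intro!: bad_points_cong)
    then show "P f a x = P f' a x" by (simp add: P_def cong: conj_cong imp_cong)
  next
    fix a and f :: "real \<Rightarrow> rseq"
    define I where "I = insert a {b. lt b a} \<times> (UNIV :: nat set) \<times> lists {b. lt b a}"
    define M where "M = (\<lambda>(d, n, ps). bad_points f (C d n) ps \<union>
      (\<lambda>x. z a - x) -` bad_points (\<lambda>b. z b - f b) (C d n) ps)"
    have "{a} \<union> {b. lt b a} \<prec> (UNIV :: real set)"
      by (rule lesspoll_Un[OF _ lt(3) infinite_UNIV_real]) (simp add: countable_lesspoll_real)
    then have "I \<prec> (UNIV :: real set)"
      unfolding I_def
      by (intro lesspoll_Times lists_lesspoll_real lt(3) infinite_UNIV_real)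
        (simp_all add: countable_lesspoll_real)
    moreover have "meager (M i)" if "i \<in> I" for i
    proof -
      have "meager ((\<lambda>x. z a - x) -` bad_points (\<lambda>b. z b - f b) (C d n) ps)" for d n ps
        by (rule meager_vimage_homeomorphism[OF uminus_diff_homeomorphism uminus_diff_homeomorphism
              _ _ meager_bad_points]) simp_all
      then show ?thesis
        by (auto simp: M_def split: prod.split intro!: meager_Un meager_bad_points)
    qed
    ultimately obtain x where x: "x \<in> W a" "\<forall>i\<in>I. x \<notin> M i"
      using cov_meager_avoid[OF cov _ _ W(1,2), of I M a] by blast
    have "x \<notin> bad_points f (C d n) ps \<and> z a - x \<notin> bad_points (\<lambda>b. z b - f b) (C d n) ps"
      if "d \<in> insert a {b. lt b a}" "ps \<in> lists {b. lt b a}" for d n ps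
    proof -
      have "(d, n, ps) \<in> I" using that by (simp add: I_def)
      then have "x \<notin> M (d, n, ps)" using x(2) by blast
      then show ?thesis by (simp add: M_def)
    qed
    then show "\<exists>x. P f a x" using x(1) unfolding P_def by blast
  qed
  then obtain g where g: "\<And>a. P g a (g a)" by blast
  have avoid: "g b \<notin> bad_points g (C a n) ps" "z b - g b \<notin> bad_points (\<lambda>b. z b - g b) (C a n) ps"
    if "b = a \<or> lt a b" "\<And>p. p \<in> set ps \<Longrightarrow> lt p b" for a b n ps
  proof -
    have "a \<in> insert b {d. lt d b}" "ps \<in> lists {d. lt d b}" using that by auto
    then show "g b \<notin> bad_points g (C a n) ps"
      "z b - g b \<notin> bad_points (\<lambda>b. z b - g b) (C a n) ps"
      using g[of b] unfolding P_def by blast+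
  qed
  show thesis
  proof
    show "g a \<in> W a" for a using g[of a] by (simp add: P_def)
    show "propagates lt g a (C a n)" for a n
      by (rule propagates_if_avoids_bad_points[OF lt(2)]) (rule avoid(1))
    show "propagates lt (\<lambda>b. z b - g b) a (C a n)" for a n
      by (rule propagates_if_avoids_bad_points[OF lt(2)]) (rule avoid(2))
  qed
qed

lemma not_o_bounded_if_sum_full:
  fixes L1 L2 :: "rseq set"
  assumes zero: "0 \<in> L1" "0 \<in> L2" and full: "\<And>z. \<exists>x\<in>L1. \<exists>y\<in>L2. x + y = z"
  shows "\<not> o_bounded (L1 \<times> L2)"
proof
  assume ob: "o_bounded (L1 \<times> L2)"
  \<comment> \<open>These neighborhoods see only coordinate \<open>n\<close> of the sum of the two
    components.\<close>
  define U where "U n = {p \<in> L1 \<times> L2. \<bar>fst p n + snd p n\<bar> < 1}" for n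
  have "\<exists>V. openin (top_of_set (L1 \<times> L2)) V \<and> 0 \<in> V \<and> V \<subseteq> U n" for n
  proof -
    have 1: "continuous_on UNIV (\<lambda>p :: rseq \<times> rseq. fst p n)"
      by (rule continuous_on_product_then_coordinatewise[OF continuous_on_fst[OF continuous_on_id]])
    have 2: "continuous_on UNIV (\<lambda>p :: rseq \<times> rseq. snd p n)"
      by (rule continuous_on_product_then_coordinatewise[OF continuous_on_snd[OF continuous_on_id]])
    have "open {p :: rseq \<times> rseq. \<bar>fst p n + snd p n\<bar> < 1}"
      by (intro open_Collect_less continuous_on_rabs continuous_on_add continuous_on_const 1 2)
    moreover have "U n = (L1 \<times> L2) \<inter> {p. \<bar>fst p n + snd p n\<bar> < 1}" by (auto simp: U_def)
    ultimately have "openin (top_of_set (L1 \<times> L2)) (U n)" by (auto simp: openin_open)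
    moreover have "0 \<in> U n" using zero by (simp add: U_def zero_prod_def)
    ultimately show ?thesis by blast
  qed
  moreover have "U n \<subseteq> L1 \<times> L2" for n by (auto simp: U_def)
  ultimately have "\<forall>n. U n \<subseteq> L1 \<times> L2 \<and> (\<exists>V. openin (top_of_set (L1 \<times> L2)) V \<and> 0 \<in> V \<and> V \<subseteq> U n)"
    by simp
  from spec[OF ob[unfolded o_bounded_def], of U, THEN mp, OF this]
  obtain F where F: "\<forall>n. finite (F n) \<and> F n \<subseteq> L1 \<times> L2"
    "L1 \<times> L2 = (\<Union>n. {f + u | f u. f \<in> F n \<and> u \<in> U n})"
    by (elim exE conjE)
  \<comment> \<open>By diagonalization, \<open>z n\<close> is at least \<open>1\<close> above
    coordinate \<open>n\<close> of every sum arising from \<open>F n\<close>, so a pair with sum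
    \<open>z\<close> lies in no translate \<open>f + U n\<close> with \<open>f\<close> in
    \<open>F n\<close>.\<close>
  define z where "z n = 1 + (\<Sum>p\<in>F n. \<bar>fst p n + snd p n\<bar>)" for n
  obtain x y where xy: "x \<in> L1" "y \<in> L2" "x + y = z" using full by blast
  then have "(x, y) \<in> (\<Union>n. {f + u | f u. f \<in> F n \<and> u \<in> U n})" unfolding F(2)[symmetric] by simp
  then obtain n f u where n: "f \<in> F n" "u \<in> U n" "(x, y) = f + u" by blast
  have "z n = (fst f n + snd f n) + (fst u n + snd u n)"
  proof -
    have "x = fst f + fst u" "y = snd f + snd u"
      using n(3) by (metis fst_add fst_conv, metis snd_add snd_conv)
    then show ?thesis unfolding xy(3)[symmetric] by simp
  qed
  also have "\<dots> < \<bar>fst f n + snd f n\<bar> + 1" using n(2) by (auto simp: U_def)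
  also have "\<bar>fst f n + snd f n\<bar> \<le> (\<Sum>p\<in>F n. \<bar>fst p n + snd p n\<bar>)"
    by (rule member_le_sum[OF n(1)]) (simp_all add: F(1))
  finally show False by (simp add: z_def)
qed

lemma subspace_imp_add_subgroup:
  assumes "rat_fun.subspace L"
  shows "add_subgroup L"
proof -
  have "- x \<in> L" if "x \<in> L" for x
  proof -
    have eq: "- x = rat_scale (- 1) x" by (auto simp: rat_scale_def)
    show ?thesis unfolding eq by (rule rat_fun.subspace_scale[OF assms that])
  qed
  then show ?thesis
    using rat_fun.subspace_0[OF assms] rat_fun.subspace_add[OF assms]
    by (simp add: add_subgroup_def)
qed

text \<open>The data of a stage: a sequence of Borel sets, the sum to be represented, the generator
  flag, the number of a basic open set to be hit, and which of the two sequences has to hit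
  it.\<close>

lemma stage_data_enumeration:
  "\<exists>e :: real \<Rightarrow> (nat \<Rightarrow> (nat \<Rightarrow> rseq) set) \<times> rseq \<times> bool \<times> nat \<times> bool.
    \<forall>C z s k t. range C \<subseteq> sets borel \<longrightarrow> (\<exists>a. e a = (C, z, s, k, t))"
proof -
  have "{f :: rseq. range f \<subseteq> UNIV} \<lesssim> (UNIV :: real set)"
    by (rule sequences_lepoll_real) simp
  then have "(UNIV :: rseq set) \<lesssim> (UNIV :: real set)" by simp
  moreover have "(UNIV :: (bool \<times> nat \<times> bool) set) \<lesssim> (UNIV :: real set)"
    by (intro lesspoll_imp_lepoll countable_lesspoll_real) simp
  ultimately have "{C :: nat \<Rightarrow> (nat \<Rightarrow> rseq) set. range C \<subseteq> sets borel} \<times> (UNIV :: rseq set) \<times>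
      (UNIV :: (bool \<times> nat \<times> bool) set) \<lesssim> (UNIV :: real set)"
    by (intro Times_lepoll_real sequences_lepoll_real[OF borel_lepoll_real])
  then obtain e where "{C :: nat \<Rightarrow> (nat \<Rightarrow> rseq) set. range C \<subseteq> sets borel} \<times> (UNIV :: rseq set) \<times>
      (UNIV :: (bool \<times> nat \<times> bool) set) \<subseteq> range (e :: real \<Rightarrow> _)"
    unfolding lepoll_iff by blast
  then have "\<exists>a. e a = (C, z, s, k, t)" if "range C \<subseteq> sets borel" for C z s k t
    using that by (auto dest!: subsetD[of _ _ "(C, z, s, k, t)"] simp: image_iff)
  then show ?thesis by blast
qed

theorem theorem9:
  assumes "cov_meager_eq_continuum"
  shows "\<exists>L1 L2 :: (nat \<Rightarrow> real) set.
           add_subgroup L1 \<and> add_subgroup L2 \<and>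
           rat_fun.subspace L1 \<and> rat_fun.subspace L2 \<and>
           Luzin (UNIV :: real set) L1 \<and> Luzin (UNIV :: real set) L2 \<and>
           S1 (borel_omega_covers L1) (borel_omega_covers L1) \<and>
           S1 (borel_omega_covers L2) (borel_omega_covers L2) \<and>
           \<not> o_bounded (L1 \<times> L2)"
proof -
  obtain lt :: "real \<Rightarrow> real \<Rightarrow> bool" where lt: "wfP lt" "transp lt" "totalp lt"
    "\<And>a. {b. lt b a} \<prec> (UNIV :: real set)"
    using continuum_wellorder_exists by blast
  obtain V :: "nat \<Rightarrow> rseq set" where V: "\<And>n. open (V n)" "\<And>n. V n \<noteq> {}"
    and V_base: "\<And>U n. open U \<Longrightarrow> U \<noteq> {} \<Longrightarrow> \<exists>k\<ge>n. closure (V k) \<subseteq> U"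
    using shrink_sequence_exists by metis
  obtain e :: "real \<Rightarrow> (nat \<Rightarrow> (nat \<Rightarrow> rseq) set) \<times> rseq \<times> bool \<times> nat \<times> bool"
    where e: "\<And>C z s k t. range C \<subseteq> sets borel \<Longrightarrow> \<exists>a. e a = (C, z, s, k, t)"
    using stage_data_enumeration by blast
  define C where "C a = fst (e a)" for a
  define z where "z a = fst (snd (e a))" for a
  define gen where "gen a = fst (snd (snd (e a)))" for a
  define target where "target a = V (fst (snd (snd (snd (e a)))))" for a
  define side where "side a = snd (snd (snd (snd (e a))))" for a
  have stage: "\<exists>a. C a = C' \<and> z a = z' \<and> gen a = s \<and> target a = V k \<and> side a = t"
    if C': "range C' \<subseteq> sets borel" for C' z' s k t
  proof -
    obtain a where "e a = (C', z', s, k, t)" using e[OF C'] by blast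
    then show ?thesis
      unfolding C_def z_def gen_def target_def side_def by (intro exI[of _ a]) simp
  qed
  \<comment> \<open>\<open>g a\<close> and \<open>z a - g a\<close> determine each other, so a stage
    sends only one of them into its target; for the second one the target is pulled back to a
    condition on \<open>g a\<close>.\<close>
  define W where "W a = (if side a then target a else (\<lambda>x. z a - x) -` target a)" for a
  have "open (W a)" for a
    using V(1) by (auto simp: W_def target_def intro: open_vimage uminus_diff_homeomorphism)
  moreover have "W a \<noteq> {}" for a
  proof -
    obtain x where "x \<in> target a" using V(2) by (fastforce simp: target_def)
    then have "z a - x \<in> (\<lambda>x. z a - x) -` target a" by simp
    then show ?thesis using \<open>x \<in> target a\<close> by (cases "side a") (auto simp only: W_def if_True if_False)
  qed
  ultimately obtain g where g: "\<And>a. g a \<in> W a" "\<And>a n. propagates lt g a (C a n)"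
    "\<And>a n. propagates lt (\<lambda>b. z b - g b) a (C a n)"
    using simultaneous_generic_sequences[OF assms lt(1,3,4), of W C z] by metis
  define h where "h a = z a - g a" for a
  \<comment> \<open>The constant sequences as values of \<open>z\<close> already give continuum many
    stages with the same flags.\<close>
  have many: "(UNIV :: real set) \<lesssim> {a. gen a \<and> target a = V k \<and> side a = t}" for k t
  proof -
    have "\<exists>a. z a = (\<lambda>_. r) \<and> gen a \<and> target a = V k \<and> side a = t" for r
      using stage[of "\<lambda>_. {}" "\<lambda>_. r" True k t] by auto
    then obtain a where a: "\<And>r. z (a r) = (\<lambda>_. r) \<and> gen (a r) \<and> target (a r) = V k \<and> side (a r) = t"
      by metis
    then have "inj a" by (metis injI)
    then show ?thesis unfolding lepoll_def using a by blast
  qed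
  have late: "\<exists>b. lt a b \<and> gen b \<and> target b = V k \<and> side b = t" for a k t
  proof (rule ccontr)
    assume "\<nexists>b. lt a b \<and> gen b \<and> target b = V k \<and> side b = t"
    then have "{b. gen b \<and> target b = V k \<and> side b = t} \<subseteq> {a} \<union> {b. lt b a}"
      using lt(3) by (auto simp: totalp_on_def)
    then have "(UNIV :: real set) \<lesssim> {a} \<union> {b. lt b a}"
      using lepoll_trans[OF many subset_imp_lepoll] by blast
    moreover have "{a} \<union> {b. lt b a} \<prec> (UNIV :: real set)"
      by (rule lesspoll_Un[OF _ lt(4) infinite_UNIV_real]) (simp add: countable_lesspoll_real)
    ultimately show False using lesspoll_trans1 lesspoll_not_refl by blast
  qed
  \<comment> \<open>\<open>t\<close> is the side on which the sequence meets its targets, so one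
    argument serves both \<open>g\<close> and \<open>h\<close>.\<close>
  have generic: "generic_sequence lt gen k"
    if propagates: "\<And>a n. propagates lt k a (C a n)" and k: "\<And>a. side a = t \<Longrightarrow> k a \<in> target a" for k t
  proof
    show "transp lt" "wfP lt" "totalp lt" "\<And>a. {b. lt b a} \<prec> (UNIV :: real set)" by fact+
    show "(UNIV :: real set) \<lesssim> {a. gen a}"
      by (rule lepoll_trans[OF many[of 0 True] subset_imp_lepoll]) auto
    show "\<not> meager (UNIV :: (nat \<Rightarrow> rseq) set)"
      using cov_meager_avoid[OF assms countable_lesspoll_real, of "{()}" "\<lambda>_. UNIV" "UNIV :: (nat \<Rightarrow> rseq) set"]
      by auto
    show "\<exists>a. \<not> gen a \<and> (\<forall>n. propagates lt k a (C' n))"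
      if C': "range C' \<subseteq> sets borel" for C' :: "nat \<Rightarrow> (nat \<Rightarrow> rseq) set"
      using stage[OF C', of 0 False 0 True] propagates by metis
    show "\<exists>b. lt a b \<and> gen b \<and> k b \<in> U" if U: "open U" "U \<noteq> {}" for U a
    proof -
      obtain i where "V i \<subseteq> U" using V_base[OF U, of 0] closure_subset by blast
      then show ?thesis using late[of a i t] k by blast
    qed
  qed
  interpret G: generic_sequence lt gen g
  proof (rule generic[OF g(2), of True])
    show "g a \<in> target a" if "side a = True" for a using g(1)[of a] that by (simp add: W_def)
  qed
  interpret H: generic_sequence lt gen h
  proof (rule generic[of _ False])
    show "propagates lt h a (C a n)" for a n using g(3) by (simp add: h_def[abs_def])
    show "h a \<in> target a" if "side a = False" for a using g(1)[of a] that by (simp add: W_def h_def)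
  qed
  have sub: "rat_fun.subspace G.L" "rat_fun.subspace H.L"
    by (simp_all add: G.L_def H.L_def rat_fun.subspace_span)
  moreover have "\<not> o_bounded (G.L \<times> H.L)"
  proof (rule not_o_bounded_if_sum_full)
    show "0 \<in> G.L" "0 \<in> H.L" using sub rat_fun.subspace_0 by blast+
    fix y :: rseq
    \<comment> \<open>A generator stage with \<open>z a = y\<close> exists, and there
      \<open>y\<close> was split as \<open>g a + h a\<close>.\<close>
    obtain a where a: "z a = y" "gen a"
      using stage[of "\<lambda>_. {}" y True 0 True] by auto
    have "g a \<in> G.L" "h a \<in> H.L"
      unfolding G.L_def H.L_def using a(2) by (auto intro: rat_fun.span_base)
    moreover have "g a + h a = y" using a(1) by (simp add: h_def)
    ultimately show "\<exists>x\<in>G.L. \<exists>x'\<in>H.L. x + x' = y" by blast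
  qed
  ultimately show ?thesis
    using subspace_imp_add_subgroup G.Luzin_L H.Luzin_L G.S1_L H.S1_L by blast
qed

end
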